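(* Let $q\ge 2$ be an integer, $\Lambda=\{0,1,\dots,q-1\}$, and let $T:I^d\to I^d$ be a product of expansive Markov maps that is conjugate to the full shift on the $q$ symbols of $\Lambda$. Let $w$ be any word of length $n$ and let $w_1,w_2,\dots,w_k$ be a collection of words of length $m\ge n$, all with symbols from $\Lambda$, with $k=q^{m-n}$, which satisfies property (P): $(w_iw_i)_z=z^{m-1}$ for every $i$, and $(w_iw_j)_z=0$ for every $i\neq j$. Then $$\rho(R_w)<\rho(R_{w_1}\cup R_{w_2}\cup\dots\cup R_{w_k}).$$
   Context: Expansive Markov map: $I$ is a closed interval with a Markov partition $\{I_0,\dots,I_{N-1}\}$ (closed intervals with union $I$ and pairwise disjoint interiors); $f:I\to I$ is such that for all $i,j$ either $f(\mathrm{int}\,I_i)\cap \mathrm{int}\,I_j=\emptyset$ or $\mathrm{int}\,I_j\subseteq f(\mathrm{int}\,I_i)$, $f$ is smooth on each $\mathrm{int}(I_i)$, and there is $\lambda>1$ with $|f'|\ge\lambda$ on each $\mathrm{int}(I_i)$. A product of such maps $f_1,\dots,f_d$ (each with its own Markov partition) is $T(x_1,\dots,x_d)=(f_1(x_1),\dots,f_d(x_d))$ on $I^d$. Full shift: $\Sigma_q^+=\Lambda^{\mathbb N}$ with left shift $\sigma$. For a word $w$, the cylinder $C_w$ is the set of sequences in $\Sigma_q^+$ beginning with $w$. $\Sigma_q^+$ carries the $\sigma$-invariant probability measure $\mu$ with $\mu(C_w)=q^{-|w|}$ for every word $w$ of length $|w|$. "$T$ is conjugate to the full shift" means that, with respect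 to the measure $\tilde\mu$ on $I^d$ induced from $\mu$ by the coding map $\pi:\Sigma_q^+\to I^d$, $\pi$ is a metric conjugacy (a measure-preserving bijection off null sets, with $\pi\circ\sigma=T\circ\pi$). $R_w\subseteq I^d$ denotes the (basic) rectangle corresponding to $C_w$ under $\pi$; thus $\tilde\mu(R_w)=q^{-|w|}$, and with $k=q^{m-n}$ the two holes $R_w$ and $R_{w_1}\cup\dots\cup R_{w_k}$ have the same measure. Escape rate: for a measure-preserving map $T$ on a probability space $(X,\mathcal B,\nu)$ and a hole $A\in\mathcal B$ with $\nu(A)>0$, $\rho(A)=-\lim_{h\to\infty}\frac1h\ln\nu(X\setminus\Omega_h(A))$ (when the limit exists), where $\Omega_h(A)=\bigcup_{j=0}^h T^{-j}(A)$. Here it is taken for $T$ on $(I^d,\tilde\mu)$. The escape rate is invariant under metric conjugacy, so $\rho(R_{w_1}\cup\dots\cup R_{w_k})$ is the escape rate of $(\Sigma_q^+,\sigma,\mu)$ into $C_{w_1}\cup\dots\cup C_{w_k}$. Correlation polynomial: for words $u,w$ with $u$ of length $n_1$, place a copy of $w$ under $u$ shifted to the right by $\ell$ positions, $0\le \ell\le n_1-1$; set $b_{\ell+1}=1$ if the overlapping parts agree and $b_{\ell+1}=0$ otherwise. Then $(uw)_z=b_1z^{n_1-1}+b_2z^{n_1-2}+\dots+b_{n_1}$.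
   Formalization: Words are taken nonempty (n≥1), and the case m=n with (ww)_z=z^{n-1} is excluded: there k=1 and the two escape rates are equal (e.g. w=w_1=01 for the doubling map), so the strict inequality is false. *)

theory Defs
  imports "HOL-Probability.Probability" "HOL-Computational_Algebra.Polynomial"
begin

section \<open>Expansive Markov maps and their products\<close>

definition closed_interval :: "real set \<Rightarrow> bool" where
  "closed_interval J \<longleftrightarrow> (\<exists>a b. a < b \<and> J = {a..b})"

definition markov_partition :: "real set \<Rightarrow> real set set \<Rightarrow> bool" where
  "markov_partition I \<P> \<longleftrightarrow>
     closed_interval I \<and> finite \<P> \<and> (\<forall>J\<in>\<P>. closed_interval J) \<and> \<Union>\<P> = I \<and>
     (\<forall>J\<in>\<P>. \<forall>K\<in>\<P>. J \<noteq> K \<longrightarrow> interior J \<inter> interior K = {})"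

definition smooth_on_open :: "real set \<Rightarrow> (real \<Rightarrow> real) \<Rightarrow> bool" where
  "smooth_on_open U f \<longleftrightarrow> (\<forall>k. \<forall>x\<in>U. ((deriv ^^ k) f) field_differentiable (at x))"

text \<open>No condition, beyond \<^term>\<open>f ` I \<subseteq> I\<close>, is imposed on \<^term>\<open>f\<close> at the end points of
  the partition intervals.\<close>

definition expansive_markov_map :: "real set \<Rightarrow> real set set \<Rightarrow> (real \<Rightarrow> real) \<Rightarrow> bool" where
  "expansive_markov_map I \<P> f \<longleftrightarrow>
     markov_partition I \<P> \<and> f ` I \<subseteq> I \<and>
     (\<forall>J\<in>\<P>. \<forall>K\<in>\<P>. f ` interior J \<inter> interior K = {} \<or> interior K \<subseteq> f ` interior J) \<and>
     (\<forall>J\<in>\<P>. smooth_on_open (interior J) f) \<and>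
     (\<exists>c>1. \<forall>J\<in>\<P>. \<forall>x\<in>interior J. \<bar>deriv f x\<bar> \<ge> c)"

definition cube :: "real set \<Rightarrow> (real ^ 'd) set" where
  "cube I = {x. \<forall>i. x $ i \<in> I}"

definition product_map :: "('d \<Rightarrow> real \<Rightarrow> real) \<Rightarrow> real ^ 'd \<Rightarrow> real ^ 'd" where
  "product_map f x = (\<chi> i. f i (x $ i))"

definition product_partition :: "('d \<Rightarrow> real set set) \<Rightarrow> (real ^ 'd) set set" where
  "product_partition \<P> = {{x. \<forall>i. x $ i \<in> J i} | J. \<forall>i. J i \<in> \<P> i}"


section \<open>The full shift and the coding map\<close>

text \<open>The set of sequences is \<^term>\<open>streams {..<q}\<close>, the shift is \<^term>\<open>stl\<close>, and the
  cylinder of a word \<^term>\<open>w\<close> is \<^term>\<open>sstart {..<q} w\<close>.\<close>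

definition shift_measure :: "nat \<Rightarrow> nat stream measure" where
  "shift_measure q = stream_space (uniform_count_measure {..<q})"

text \<open>Points of \<^term>\<open>cube I\<close> whose orbit under \<^term>\<open>T\<close> starts by visiting the open rectangles
  \<^term>\<open>interior (R (w ! 0))\<close>, \<^term>\<open>interior (R (w ! 1))\<close>, and so on.\<close>

definition open_itinerary ::
    "real set \<Rightarrow> (real ^ 'd \<Rightarrow> real ^ 'd) \<Rightarrow> (nat \<Rightarrow> (real ^ 'd) set) \<Rightarrow> nat list \<Rightarrow> (real ^ 'd) set" where
  "open_itinerary I T R w = {x \<in> cube I. \<forall>j<length w. (T ^^ j) x \<in> interior (R (w ! j))}"

text \<open>\<^term>\<open>R\<close> labels the rectangles of the partition by the symbols; the coding map sends a
  sequence to the only point of the associated nested intersection of closed sets.\<close>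

definition coding_map ::
    "nat \<Rightarrow> real set \<Rightarrow> (real ^ 'd \<Rightarrow> real ^ 'd) \<Rightarrow> (nat \<Rightarrow> (real ^ 'd) set) \<Rightarrow> (nat stream \<Rightarrow> real ^ 'd) \<Rightarrow> bool" where
  "coding_map q I T R \<pi> \<longleftrightarrow>
     (\<forall>s\<in>streams {..<q}. (\<Inter>n. closure (open_itinerary I T R (stake n s))) = {\<pi> s})"

definition induced_measure :: "nat \<Rightarrow> real set \<Rightarrow> (nat stream \<Rightarrow> real ^ 'd) \<Rightarrow> (real ^ 'd) measure" where
  "induced_measure q I \<pi> = distr (shift_measure q) (restrict_space borel (cube I)) \<pi>"

definition metric_conjugacy ::
    "'a measure \<Rightarrow> ('a \<Rightarrow> 'a) \<Rightarrow> 'b measure \<Rightarrow> ('b \<Rightarrow> 'b) \<Rightarrow> ('a \<Rightarrow> 'b) \<Rightarrow> bool" where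
  "metric_conjugacy M S N T \<phi> \<longleftrightarrow>
     \<phi> \<in> measurable M N \<and>
     (\<forall>A\<in>sets N. emeasure M (\<phi> -` A \<inter> space M) = emeasure N A) \<and>
     (\<exists>Z\<in>null_sets M. \<exists>Z'\<in>null_sets N.
        bij_betw \<phi> (space M - Z) (space N - Z') \<and>
        (\<forall>x\<in>space M - Z. \<phi> (S x) = T (\<phi> x)))"

definition conjugate_to_full_shift ::
    "nat \<Rightarrow> real set \<Rightarrow> ('d \<Rightarrow> real set set) \<Rightarrow> (real ^ 'd \<Rightarrow> real ^ 'd) \<Rightarrow>
     (nat \<Rightarrow> (real ^ 'd) set) \<Rightarrow> (nat stream \<Rightarrow> real ^ 'd) \<Rightarrow> bool" where
  "conjugate_to_full_shift q I \<P> T R \<pi> \<longleftrightarrow>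
     bij_betw R {..<q} (product_partition \<P>) \<and>
     coding_map q I T R \<pi> \<and>
     metric_conjugacy (shift_measure q) stl (induced_measure q I \<pi>) T \<pi>"

text \<open>Since the coding map is defined by closures, the image of a cylinder is the closed rectangle, i.e.
  the closure of the open itinerary set of the word.\<close>

definition rectangle :: "nat \<Rightarrow> (nat stream \<Rightarrow> real ^ 'd) \<Rightarrow> nat list \<Rightarrow> (real ^ 'd) set" where
  "rectangle q \<pi> w = \<pi> ` sstart {..<q} w"


section \<open>Escape rates\<close>

definition hitting_set :: "'a measure \<Rightarrow> ('a \<Rightarrow> 'a) \<Rightarrow> 'a set \<Rightarrow> nat \<Rightarrow> 'a set" where
  "hitting_set M T A h = (\<Union>j\<le>h. (T ^^ j) -` A \<inter> space M)"

text \<open>The HOL convention \<^prop>\<open>ln 0 = (0 :: real)\<close> would give escape rate 0 to a hole swallowing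
  almost every point; extended reals give it escape rate \<^term>\<open>\<infinity> :: ereal\<close>.\<close>

definition ln_ext :: "real \<Rightarrow> ereal" where
  "ln_ext x = (if x = 0 then - \<infinity> else ereal (ln x))"

definition survival_exponent :: "'a measure \<Rightarrow> ('a \<Rightarrow> 'a) \<Rightarrow> 'a set \<Rightarrow> nat \<Rightarrow> ereal" where
  "survival_exponent M T A h =
     ereal (1 / real h) * ln_ext (measure M (space M - hitting_set M T A h))"

definition escape_rate :: "'a measure \<Rightarrow> ('a \<Rightarrow> 'a) \<Rightarrow> 'a set \<Rightarrow> ereal" where
  "escape_rate M T A = - lim (survival_exponent M T A)"

text \<open>The conditions under which \<^const>\<open>escape_rate\<close> is meaningful.\<close>

definition escape_rate_defined :: "'a measure \<Rightarrow> ('a \<Rightarrow> 'a) \<Rightarrow> 'a set \<Rightarrow> bool" where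
  "escape_rate_defined M T A \<longleftrightarrow>
     prob_space M \<and> T \<in> measurable M M \<and> distr M M T = M \<and>
     A \<in> sets M \<and> 0 < measure M A \<and> convergent (survival_exponent M T A)"


section \<open>Correlation polynomials\<close>

definition overlap_agrees :: "'a list \<Rightarrow> 'a list \<Rightarrow> nat \<Rightarrow> bool" where
  "overlap_agrees u w l \<longleftrightarrow> (\<forall>i. l + i < length u \<and> i < length w \<longrightarrow> u ! (l + i) = w ! i)"

definition correlation_poly :: "'a list \<Rightarrow> 'a list \<Rightarrow> int poly" where
  "correlation_poly u w =
     (\<Sum>l<length u. monom (if overlap_agrees u w l then 1 else 0) (length u - 1 - l))"

definition property_P :: "nat \<Rightarrow> nat \<Rightarrow> (nat \<Rightarrow> 'a list) \<Rightarrow> bool" where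
  "property_P m k ws \<longleftrightarrow>
     (\<forall>i\<in>{1..k}. correlation_poly (ws i) (ws i) = monom 1 (m - 1)) \<and>
     (\<forall>i\<in>{1..k}. \<forall>j\<in>{1..k}. i \<noteq> j \<longrightarrow> correlation_poly (ws i) (ws j) = 0)"


section \<open>Normalisation of the shift measure\<close>

lemma emeasure_cylinder:
  assumes "q > 0" "set w \<subseteq> {..<q}"
  shows "emeasure (shift_measure q) (sstart {..<q} w) = ennreal ((1 / real q) ^ length w)"
  using assms(2)
proof (induction w)
  interpret U: prob_space "uniform_count_measure {..<q}"
    using assms(1) by (intro prob_space_uniform_count_measure) auto
  interpret P: prob_space "shift_measure q"
    unfolding shift_measure_def by (rule U.prob_space_stream_space)
  have space: "space (shift_measure q) = streams {..<q}"
    by (simp add: shift_measure_def space_stream_space space_uniform_count_measure)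
  {
    case Nil
    then show ?case using P.emeasure_space_1 by (simp add: space)
  next
    case (Cons a w)
    have sets: "sets (shift_measure q) = sets (stream_space (count_space {..<q}))"
      unfolding shift_measure_def
      by (intro sets_stream_space_cong) (simp add: sets_uniform_count_measure)
    have meas: "sstart {..<q} v \<in> sets (shift_measure q)" if "set v \<subseteq> {..<q}" for v
    proof -
      have "sstart ({..<q} :: nat set) ` lists {..<q} \<union> {{}} \<subseteq> Pow (streams {..<q})"
        using sstart_in_streams[of _ "{..<q}"] by blast
      moreover have "v \<in> lists {..<q}" using that by auto
      ultimately show ?thesis
        unfolding sets sets_stream_space_sstart[OF countableI_type[of "{..<q}"]]
        by (subst sets_measure_of) (auto intro: sigma_sets.Basic)
    qed
    have "emeasure (shift_measure q) (sstart {..<q} (a # w)) =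
       (\<integral>\<^sup>+t. emeasure (shift_measure q) {x\<in>space (shift_measure q). t ## x \<in> sstart {..<q} (a # w)}
          \<partial>uniform_count_measure {..<q})"
      using meas[OF Cons.prems] unfolding shift_measure_def by (rule U.emeasure_stream_space)
    also have "\<dots> = (\<integral>\<^sup>+t. emeasure (shift_measure q) (sstart {..<q} w) * indicator {a} t
          \<partial>uniform_count_measure {..<q})"
    proof (intro nn_integral_cong)
      fix t
      have "sstart {..<q} w \<subseteq> streams {..<q}"
        using Cons.prems by (intro sstart_in_streams) auto
      then have "{x\<in>space (shift_measure q). t ## x \<in> sstart {..<q} (a # w)} =
          (if t = a then sstart {..<q} w else {})"
        by (auto simp: space)
      then show "emeasure (shift_measure q) {x\<in>space (shift_measure q). t ## x \<in> sstart {..<q} (a # w)} =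
          emeasure (shift_measure q) (sstart {..<q} w) * indicator {a} t"
        by simp
    qed
    also have "\<dots> = emeasure (shift_measure q) (sstart {..<q} w) *
        emeasure (uniform_count_measure {..<q}) {a}"
      using Cons.prems by (subst nn_integral_cmult_indicator) (auto simp: sets_uniform_count_measure)
    also have "\<dots> = ennreal ((1 / real q) ^ length w) * ennreal (1 / real q)"
      using Cons by (simp add: emeasure_uniform_count_measure)
    also have "\<dots> = ennreal ((1 / real q) ^ length (a # w))"
      by (subst ennreal_mult[symmetric]) (auto simp: mult.commute)
    finally show ?case .
  }
qed

end

theory Submission
  imports Defs
begin

text \<open>Almost every sequence \<^term>\<open>s\<close> has the property that the point coded by each of its shifts lies in the
  open rectangle of the first symbol of that shift. For such \<^term>\<open>s\<close> the coded point lies in the closed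
  rectangle of a word exactly if \<^term>\<open>s\<close> starts with that word (\<open>generic_rectangle_iff\<close>), so the
  probability of surviving up to time \<open>h\<close> is the proportion \<open>a (h + L)\<close> of words of length \<open>h + L\<close> that
  avoid the given words, all of length \<open>L\<close> (\<open>measure_survivors\<close>). Apart from the null set
  excluded by the conjugacy, the exceptional sequences are those with an orbit point on a partition hyperplane
  \<open>x $ i = c\<close>. Hyperplanes are null because at most three coordinate
  words of each length have an itinerary interval accumulating at \<open>c\<close>, and, since an expanding self-map of
  an interval needs at least two cells, each of these coordinate words has exponentially small probability
  (\<open>coding_avoids_hyperplane\<close>).

  The rest is a comparison of two counting problems. Let \<open>a l\<close> and \<open>p l\<close> be the proportions of words of
  length \<open>l\<close> that avoid \<open>w\<close>, respectively all of \<open>w\<^sub>1, ..., w\<^sub>k\<close>, and put \<open>e = q ^ - n\<close>, the common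
  measure of the holes. The loss \<open>a l - a (l + 1)\<close> comes from the words that contain \<open>w\<close> for the first time at their
  end. Such a word is an avoiding word followed by \<open>w\<close>, so the loss is at most \<open>e * a (l + 1 - n)\<close>; when
  the hole words have no overlaps, every avoiding word followed by a hole word is a first hit, so
  \<open>p (l + 1) = p l - e * p (l + 1 - m)\<close> exactly. The ratios of the sequence \<open>p\<close> decrease to a limit \<open>r\<close>
  with \<open>r ^ (m - 1) * (1 - r) = e\<close> (\<open>ratio_limit\<close>), unless \<open>p\<close> vanishes eventually. Conversely every
  \<open>y\<close> with \<open>y ^ (n - 1) * (1 - y) \<ge> e\<close> bounds the ratios of \<open>a\<close> from below (\<open>ratio_lower_bound\<close>). If
  \<open>n < m\<close>, then \<open>r ^ (n - 1) * (1 - r) > e\<close>, which leaves room for some \<open>y > r\<close>. If \<open>n = m\<close>, then \<open>w\<close>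
  overlaps itself at some shift \<open>t > 0\<close>, and this reduces the loss: a first hit
  followed by the last \<open>t\<close> letters of \<open>w\<close> is again an avoiding word followed by \<open>w\<close>, but no first hit. In terms of
  \<open>b l = a l + q ^ - t * a (l - t)\<close> this replaces \<open>e\<close> by the smaller \<open>e / (1 + q ^ - t)\<close>, and again
  some \<open>y > r\<close> is available (\<open>avoidance_prob_beats_rate\<close>). Existence of the escape rates is Fekete's lemma.\<close>

section \<open>Words avoiding a set of words\<close>

definition occurs_at :: "'a list \<Rightarrow> 'a list \<Rightarrow> nat \<Rightarrow> bool" where
  "occurs_at u v p \<longleftrightarrow> p + length u \<le> length v \<and> (\<forall>i<length u. v ! (p + i) = u ! i)"

definition avoids :: "'a list set \<Rightarrow> 'a list \<Rightarrow> bool" where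
  "avoids W v \<longleftrightarrow> (\<forall>u\<in>W. \<forall>p. \<not> occurs_at u v p)"

definition avoiders :: "'a set \<Rightarrow> 'a list set \<Rightarrow> nat \<Rightarrow> 'a list set" where
  "avoiders A W l = {v. set v \<subseteq> A \<and> length v = l \<and> avoids W v}"

text \<open>Prefixes of avoiding words avoid \<open>W\<close> as well, so testing the longest proper prefix suffices.\<close>

definition first_hits :: "'a set \<Rightarrow> 'a list set \<Rightarrow> nat \<Rightarrow> 'a list set" where
  "first_hits A W l =
     {v. set v \<subseteq> A \<and> length v = l \<and> \<not> avoids W v \<and> avoids W (take (l - 1) v)}"

lemma occurs_at_take: "occurs_at u (take j v) p \<longleftrightarrow> occurs_at u v p \<and> p + length u \<le> j"
  by (auto simp: occurs_at_def)

lemma occurs_at_drop: "occurs_at u (drop j v) p \<Longrightarrow> occurs_at u v (min j (length v) + p)"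
  by (cases "j \<le> length v") (auto simp: occurs_at_def add.assoc)

lemma avoids_take: "avoids W v \<Longrightarrow> avoids W (take j v)"
  by (auto simp: avoids_def occurs_at_take)

lemma avoids_drop: "avoids W v \<Longrightarrow> avoids W (drop j v)"
  by (auto simp: avoids_def dest: occurs_at_drop)

lemma finite_words: "finite A \<Longrightarrow> finite {v. set v \<subseteq> A \<and> length v = l \<and> P v}"
  by (rule finite_subset[OF _ finite_lists_length_eq[of A l]]) auto

lemma finite_avoiders: "finite A \<Longrightarrow> finite (avoiders A W l)"
  unfolding avoiders_def by (rule finite_words)

lemma finite_first_hits: "finite A \<Longrightarrow> finite (first_hits A W l)"
  unfolding first_hits_def by (rule finite_words)

text \<open>Appending a letter to an avoiding word gives either an avoiding word or a first hit, and every such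
  word arises once.\<close>

lemma card_avoiders_Suc:
  assumes "finite A"
  shows "card (avoiders A W (Suc l)) + card (first_hits A W (Suc l)) = card A * card (avoiders A W l)"
proof -
  have "avoiders A W (Suc l) \<union> first_hits A W (Suc l) = (\<lambda>(v, a). v @ [a]) ` (avoiders A W l \<times> A)"
    (is "?L = ?R")
  proof
    show "?L \<subseteq> ?R"
    proof
      fix x assume x: "x \<in> ?L"
      then have len: "length x = Suc l" and "set x \<subseteq> A" and av: "avoids W (take l x)"
        by (auto simp: avoiders_def first_hits_def intro: avoids_take)
      moreover have "x = take l x @ [x ! l]"
        using len by (metis lessI take_Suc_conv_app_nth take_all_iff order_refl)
      moreover have "x ! l \<in> A" using len \<open>set x \<subseteq> A\<close> by (metis lessI nth_mem subsetD)
      moreover have "take l x \<in> avoiders A W l"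
        using len \<open>set x \<subseteq> A\<close> av by (auto simp: avoiders_def dest: in_set_takeD)
      ultimately show "x \<in> ?R" by (intro image_eqI[of _ _ "(take l x, x ! l)"]) auto
    qed
    show "?R \<subseteq> ?L" by (auto simp: avoiders_def first_hits_def)
  qed
  moreover have "avoiders A W (Suc l) \<inter> first_hits A W (Suc l) = {}"
    by (auto simp: avoiders_def first_hits_def)
  moreover have "inj_on (\<lambda>(v, a). v @ [a]) (avoiders A W l \<times> A)"
    by (auto simp: inj_on_def)
  ultimately show ?thesis
    using card_Un_disjoint[OF finite_avoiders[OF assms] finite_first_hits[OF assms]]
    by (metis card_cartesian_product card_image mult.commute)
qed

lemma card_avoiders_add:
  assumes "finite A"
  shows "card (avoiders A W (i + j)) \<le> card (avoiders A W i) * card (avoiders A W j)"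
proof -
  have "inj_on (\<lambda>v. (take i v, drop i v)) (avoiders A W (i + j))"
    by (intro inj_onI) (metis append_take_drop_id prod.inject)
  moreover have "(\<lambda>v. (take i v, drop i v)) ` avoiders A W (i + j) \<subseteq> avoiders A W i \<times> avoiders A W j"
    by (auto simp: avoiders_def avoids_take avoids_drop dest: in_set_takeD in_set_dropD)
  ultimately have "card (avoiders A W (i + j)) \<le> card (avoiders A W i \<times> avoiders A W j)"
    using assms by (intro card_inj_on_le finite_cartesian_product finite_avoiders)
  then show ?thesis by (simp add: card_cartesian_product)
qed

lemma avoiders_short:
  assumes "\<And>u. u \<in> W \<Longrightarrow> length u = n" "l < n"
  shows "avoiders A W l = {v. set v \<subseteq> A \<and> length v = l}"
  using assms by (auto simp: avoiders_def avoids_def occurs_at_def)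

lemma occurs_at_suffix: "occurs_at u v (length v - length u) \<Longrightarrow> v = take (length v - length u) v @ u"
proof -
  assume a: "occurs_at u v (length v - length u)"
  have "drop (length v - length u) v = u"
    using a by (intro nth_equalityI) (auto simp: occurs_at_def)
  then show ?thesis by (metis append_take_drop_id)
qed

text \<open>The occurrence in a first hit must end at the last letter, since otherwise it would be visible without
  that letter.\<close>

lemma first_hitsE:
  assumes "v \<in> first_hits A W l" "\<And>u. u \<in> W \<Longrightarrow> length u = n" "0 < n"
  obtains x u where "u \<in> W" "v = x @ u" "n \<le> l" "x \<in> avoiders A W (l - n)"
proof -
  from assms(1) have v: "set v \<subseteq> A" "length v = l" "avoids W (take (l - 1) v)"
    by (auto simp: first_hits_def)
  from assms(1) obtain u p where u: "u \<in> W" "occurs_at u v p"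
    by (auto simp: first_hits_def avoids_def)
  have "\<not> p + length u \<le> l - 1" using v(3) u by (auto simp: avoids_def occurs_at_take)
  then have p: "p = l - n" "n \<le> l" using u(2) assms(2)[OF u(1)] \<open>0 < n\<close> v(2) by (auto simp: occurs_at_def)
  have eq: "v = take (l - n) v @ u"
    using occurs_at_suffix[of u v] u p v assms(2) by metis
  have "take (l - n) v = take (l - n) (take (l - 1) v)" using \<open>0 < n\<close> by (simp add: min_def)
  then have "avoids W (take (l - n) v)" using v(3) by (metis avoids_take)
  then have "take (l - n) v \<in> avoiders A W (l - n)"
    using v p by (auto simp: avoiders_def dest: in_set_takeD)
  with eq u p show thesis using that by blast
qed

lemma first_hits_subset:
  assumes "\<And>u. u \<in> W \<Longrightarrow> length u = n" "0 < n"
  shows "first_hits A W (L + n) \<subseteq> (\<lambda>(x, u). x @ u) ` (avoiders A W L \<times> W)"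
proof
  fix v assume "v \<in> first_hits A W (L + n)"
  from first_hitsE[OF this assms] show "v \<in> (\<lambda>(x, u). x @ u) ` (avoiders A W L \<times> W)"
    by auto
qed

lemma card_first_hits_single:
  assumes "finite A" "length w = n" "0 < n"
  shows "card (first_hits A {w} (L + n)) \<le> card (avoiders A {w} L)"
proof -
  have "first_hits A {w} (L + n) \<subseteq> (\<lambda>x. x @ w) ` avoiders A {w} L"
    using first_hits_subset[of "{w}" n A L] assms by auto
  then show ?thesis using assms(1) by (metis surj_card_le finite_avoiders)
qed

text \<open>If \<open>w\<close> overlaps itself at shift \<open>t\<close>, appending the last \<open>t\<close> letters of \<open>w\<close> to a shorter first
  hit produces a word that again consists of an avoiding word followed by \<open>w\<close>. It contains \<open>w\<close> before
  its end, so it is not a first hit. Hence the two families of words counted on the left are disjoint inside the set of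
  all words of that form.\<close>

lemma card_first_hits_overlap:
  assumes "finite A" "length w = n" "0 < t" "t < n" "overlap_agrees w w t"
  shows "card (first_hits A {w} (L + n)) + card (first_hits A {w} (L + n - t)) \<le> card (avoiders A {w} L)"
proof -
  let ?z = "drop (n - t) w"
  let ?S = "(\<lambda>x. x @ ?z) ` first_hits A {w} (L + n - t)"
  have overlap: "drop t w = take (n - t) w"
    using assms by (intro nth_equalityI) (auto simp: overlap_agrees_def less_diff_conv add.commute)
  have "?S \<subseteq> (\<lambda>x. x @ w) ` avoiders A {w} L"
  proof
    fix y assume "y \<in> ?S"
    then obtain x where x: "x \<in> first_hits A {w} (L + n - t)" and y: "y = x @ ?z" by auto
    from first_hitsE[OF x, of n] assms obtain x' where x': "x = x' @ w" "n \<le> L + n - t" "x' \<in> avoiders A {w} (L + n - t - n)"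
      by (metis singletonD gr_zeroI not_less_zero)
    from x have lx: "length x = L + n - t" "set x \<subseteq> A" "avoids {w} (take (L + n - t - 1) x)"
      by (auto simp: first_hits_def)
    have "y = x' @ take t w @ take (n - t) w @ ?z"
      using x' y overlap by (metis append.assoc append_take_drop_id)
    then have "y = (x' @ take t w) @ w" by simp
    moreover have "x' @ take t w = take L (take (L + n - t - 1) x)"
    proof -
      have "length x' + t = L" using lx x' assms by auto
      then show ?thesis using assms x' by (auto simp: min_def)
    qed
    moreover have "x' @ take t w \<in> avoiders A {w} L"
      using avoids_take[OF lx(3), of L] lx assms
      by (auto simp: avoiders_def calculation(2) dest!: in_set_takeD)
    ultimately show "y \<in> (\<lambda>x. x @ w) ` avoiders A {w} L" by auto
  qed
  moreover have "first_hits A {w} (L + n) \<subseteq> (\<lambda>x. x @ w) ` avoiders A {w} L"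
    using first_hits_subset[of "{w}" n A L] assms by auto
  moreover have "first_hits A {w} (L + n) \<inter> ?S = {}"
  proof -
    have "x @ ?z \<notin> first_hits A {w} (L + n)" if "x \<in> first_hits A {w} (L + n - t)" for x
    proof
      assume "x @ ?z \<in> first_hits A {w} (L + n)"
      then have "avoids {w} (take (L + n - 1) (x @ ?z))" by (simp add: first_hits_def)
      then have "avoids {w} (take (length x) (take (L + n - 1) (x @ ?z)))" by (rule avoids_take)
      moreover have "length x \<le> L + n - 1" "length x = L + n - t" using that assms by (auto simp: first_hits_def)
      ultimately have "avoids {w} x" by (simp add: min_def)
      with that show False by (auto simp: first_hits_def)
    qed
    then show ?thesis by auto
  qed
  ultimately have "card (first_hits A {w} (L + n)) + card ?S \<le> card ((\<lambda>x. x @ w) ` avoiders A {w} L)"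
    using assms(1) by (subst card_Un_disjoint[symmetric])
      (auto intro!: card_mono finite_imageI finite_avoiders finite_first_hits)
  also have "card ?S = card (first_hits A {w} (L + n - t))"
    by (intro card_image) (auto simp: inj_on_def)
  also have "card ((\<lambda>x. x @ w) ` avoiders A {w} L) = card (avoiders A {w} L)"
    by (intro card_image) (auto simp: inj_on_def)
  finally show ?thesis .
qed

text \<open>In an avoiding word followed by an element of \<open>W\<close>, any earlier occurrence of an element of \<open>W\<close> would
  have to overlap the final one. Without overlaps the bound for first hits is therefore attained.\<close>

lemma card_first_hits_uncorrelated:
  assumes "\<And>u. u \<in> W \<Longrightarrow> length u = n \<and> set u \<subseteq> A" "0 < n"
    and unc: "\<And>u v l. u \<in> W \<Longrightarrow> v \<in> W \<Longrightarrow> 0 < l \<Longrightarrow> l < n \<Longrightarrow> \<not> overlap_agrees u v l"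
  shows "card (first_hits A W (L + n)) = card (avoiders A W L) * card W"
proof -
  have "(\<lambda>(x, u). x @ u) ` (avoiders A W L \<times> W) \<subseteq> first_hits A W (L + n)"
  proof clarify
    fix x u assume x: "x \<in> avoiders A W L" and u: "u \<in> W"
    have lx: "length x = L" "set x \<subseteq> A" "avoids W x" using x by (auto simp: avoiders_def)
    have lu: "length u = n" "set u \<subseteq> A" using u assms by auto
    have "occurs_at u (x @ u) L" using lx by (auto simp: occurs_at_def)
    then have 1: "\<not> avoids W (x @ u)" using u by (auto simp: avoids_def)
    have 2: "avoids W (take (L + n - 1) (x @ u))"
    proof (unfold avoids_def, intro ballI allI notI)
      fix u' p assume u': "u' \<in> W" and "occurs_at u' (take (L + n - 1) (x @ u)) p"
      then have o: "occurs_at u' (x @ u) p" and le: "p + n \<le> L + n - 1"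
        using assms(1)[OF u'] unfolding occurs_at_take by auto
      have lu': "length u' = n" using u' assms by auto
      show False
      proof (cases "p + n \<le> L")
        case True
        then have "occurs_at u' x p" using o lx lu' by (auto simp: occurs_at_def nth_append)
        then show False using lx u' by (auto simp: avoids_def)
      next
        case False
        have "overlap_agrees u' u (L - p)"
          unfolding overlap_agrees_def
        proof (intro allI impI)
          fix i assume i: "L - p + i < length u' \<and> i < length u"
          have "(x @ u) ! (p + (L - p + i)) = u' ! (L - p + i)" using o i by (auto simp: occurs_at_def)
          moreover have "p + (L - p + i) = L + i" using le \<open>0 < n\<close> by linarith
          ultimately show "u' ! (L - p + i) = u ! i" using lx by (simp add: nth_append)
        qed
        moreover have "0 < L - p" "L - p < n" using False le \<open>0 < n\<close> by auto
        ultimately show False using unc u u' by blast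
      qed
    qed
    show "x @ u \<in> first_hits A W (L + n)" using 1 2 lx lu by (auto simp: first_hits_def)
  qed
  then have "first_hits A W (L + n) = (\<lambda>(x, u). x @ u) ` (avoiders A W L \<times> W)"
    using first_hits_subset[of W n A L] assms by blast
  moreover have "inj_on (\<lambda>(x, u). x @ u) (avoiders A W L \<times> W)"
    by (auto simp: inj_on_def avoiders_def)
  ultimately show ?thesis by (simp add: card_image card_cartesian_product)
qed

section \<open>Correlation polynomials and overlaps\<close>

text \<open>The summands are monomials of different degrees, so the coefficients of the correlation polynomial are
  exactly the overlap bits.\<close>

lemma coeff_correlation_poly:
  assumes "l < length u"
  shows "coeff (correlation_poly u w) (length u - 1 - l) = (if overlap_agrees u w l then 1 else 0)"
proof -
  have "coeff (correlation_poly u w) (length u - 1 - l) =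
     (\<Sum>l'<length u. if l' = l then (if overlap_agrees u w l then 1 else 0) else 0)"
    unfolding correlation_poly_def coeff_sum
    using assms by (intro sum.cong refl) auto
  then show ?thesis using assms by simp
qed

lemma correlation_poly_eq_0_iff:
  "correlation_poly u w = 0 \<longleftrightarrow> (\<forall>l<length u. \<not> overlap_agrees u w l)"
proof
  assume "correlation_poly u w = 0"
  then show "\<forall>l<length u. \<not> overlap_agrees u w l"
    using coeff_correlation_poly[of _ u w] by (metis coeff_0 zero_neq_one)
qed (simp add: correlation_poly_def)

lemma correlation_poly_trivial_iff:
  assumes "u \<noteq> []"
  shows "correlation_poly u u = monom 1 (length u - 1) \<longleftrightarrow>
    (\<forall>l. 0 < l \<and> l < length u \<longrightarrow> \<not> overlap_agrees u u l)"
proof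
  assume eq: "correlation_poly u u = monom 1 (length u - 1)"
  show "\<forall>l. 0 < l \<and> l < length u \<longrightarrow> \<not> overlap_agrees u u l"
  proof (intro allI impI)
    fix l assume l: "0 < l \<and> l < length u"
    then have "coeff (correlation_poly u u) (length u - 1 - l) = 0" unfolding eq by auto
    then show "\<not> overlap_agrees u u l" using coeff_correlation_poly[of l u u] l by (auto split: if_splits)
  qed
next
  assume a: "\<forall>l. 0 < l \<and> l < length u \<longrightarrow> \<not> overlap_agrees u u l"
  have "correlation_poly u u = (\<Sum>l<length u. if l = 0 then monom 1 (length u - 1) else 0)"
    unfolding correlation_poly_def
    using a by (intro sum.cong refl) (auto simp: overlap_agrees_def)
  then show "correlation_poly u u = monom 1 (length u - 1)" using assms by simp
qed

section \<open>Recursions with a delayed loss term\<close>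

text \<open>If \<open>y\<close> bounds the ratios up to index \<open>l + p\<close>, then \<open>b l \<le> y ^ - p * b (l + p)\<close>, so the delayed loss
  \<open>e * b l\<close> is at most the fraction \<open>1 - y\<close> of \<open>b (l + p)\<close>, and \<open>y\<close> also bounds the next ratio.\<close>

lemma ratio_lower_bound:
  fixes b :: "nat \<Rightarrow> real"
  assumes "0 < y" "y \<le> 1" "e \<le> y ^ p * (1 - y)" "\<And>l. 0 \<le> b l"
    and init: "\<And>l. l < p \<Longrightarrow> b l \<le> b (Suc l)"
    and rec: "\<And>l. b (l + p) - e * b l \<le> b (Suc (l + p))"
  shows "y * b l \<le> b (Suc l)"
proof (induction l rule: less_induct)
  case (less l)
  show ?case
  proof (cases "l < p")
    case True
    have "y * b l \<le> 1 * b l" using assms by (intro mult_right_mono) auto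
    then show ?thesis using init[OF True] by simp
  next
    case False
    then obtain j where j: "l = j + p" by (metis add.commute le_Suc_ex not_less)
    have "i \<le> p \<Longrightarrow> y ^ i * b j \<le> b (j + i)" for i
    proof (induction i)
      case (Suc i)
      have "y ^ Suc i * b j = y * (y ^ i * b j)" by simp
      also have "\<dots> \<le> y * b (j + i)" using Suc assms by (intro mult_left_mono) auto
      also have "\<dots> \<le> b (Suc (j + i))" using Suc j by (intro less) auto
      finally show ?case by simp
    qed simp
    then have *: "y ^ p * b j \<le> b (j + p)" by simp
    have "e * b j \<le> y ^ p * (1 - y) * b j" using assms by (intro mult_right_mono) auto
    also have "\<dots> = (1 - y) * (y ^ p * b j)" by simp
    also have "\<dots> \<le> (1 - y) * b (j + p)" using * assms by (intro mult_left_mono) auto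
    finally have "y * b l \<le> b (j + p) - e * b j" unfolding j by (simp add: algebra_simps)
    then show ?thesis using rec[of j] unfolding j by linarith
  qed
qed

text \<open>Dividing the recursion by \<open>p (l + d)\<close> expresses each ratio as \<open>1 - e\<close> divided by the product of the
  \<open>d\<close> preceding ratios. By induction the ratios decrease, and the limit solves the characteristic
  equation.\<close>

lemma ratio_limit:
  fixes p :: "nat \<Rightarrow> real"
  assumes pos: "\<And>l. 0 < p l" and e: "0 < e" "e < 1"
    and init: "\<And>l. l \<le> d \<Longrightarrow> p l = 1"
    and rec: "\<And>l. p (Suc (l + d)) = p (l + d) - e * p l"
  obtains r where "0 < r" "r < 1" "r ^ d * (1 - r) = e" "(\<lambda>l. p (Suc l) / p l) \<longlonglongrightarrow> r"
proof -
  define \<rho> where "\<rho> l = p (Suc l) / p l" for l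
  have \<rho>_pos: "0 < \<rho> l" for l using pos by (simp add: \<rho>_def)
  have \<rho>_le_1: "\<rho> l \<le> 1" for l
  proof (cases "l < d")
    case True
    then show ?thesis using init by (simp add: \<rho>_def)
  next
    case False
    then obtain j where j: "l = j + d" by (metis add.commute le_Suc_ex not_less)
    then have "p (Suc l) \<le> p l" using rec[of j] e pos[of j] by auto
    then show ?thesis using pos[of l] by (simp add: \<rho>_def)
  qed
  have step: "\<rho> (Suc l) \<le> \<rho> l" for l
  proof (induction l rule: less_induct)
    case (less l)
    show ?case
    proof (cases "l < d")
      case True
      then have "\<rho> l = 1" using init by (simp add: \<rho>_def)
      then show ?thesis using \<rho>_le_1 by simp
    next
      case False
      then obtain j where j: "l = j + d" by (metis add.commute le_Suc_ex not_less)
      have mono: "i \<le> d \<Longrightarrow> \<rho> (j + i) \<le> \<rho> j" for i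
      proof (induction i)
        case (Suc i)
        have "\<rho> (Suc (j + i)) \<le> \<rho> (j + i)" using j Suc by (intro less) auto
        then show ?case using Suc by simp
      qed simp
      \<comment> \<open>The induction hypothesis, applied along the window from \<open>j\<close> to \<open>j + d\<close>, compares the ratio that
        enters the product with the one that leaves it.\<close>
      have "p (Suc (j + d)) * p j \<le> p (Suc j) * p (j + d)"
        using mono[of d] pos by (simp add: \<rho>_def field_simps)
      then have "e * p j * p (Suc (j + d)) \<le> e * p (Suc j) * p (j + d)"
        using e by (simp add: mult_left_mono mult.assoc mult.commute)
      then have "e * p j / p (j + d) \<le> e * p (Suc j) / p (Suc (j + d))"
        using pos by (simp add: divide_simps mult.commute mult.left_commute)
      moreover have "\<rho> (j + d) = 1 - e * p j / p (j + d)"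
        using rec[of j] pos[of "j + d"] by (simp add: \<rho>_def field_simps)
      moreover have "\<rho> (Suc (j + d)) = 1 - e * p (Suc j) / p (Suc (j + d))"
        using rec[of "Suc j"] pos[of "Suc (j + d)"] by (simp add: \<rho>_def field_simps)
      ultimately show ?thesis unfolding j by simp
    qed
  qed
  then have "decseq \<rho>" by (simp add: decseq_Suc_iff)
  then obtain r where lim: "\<rho> \<longlonglongrightarrow> r"
    using decseq_convergent[of \<rho> 0] \<rho>_pos by (metis less_imp_le)
  have shifted: "(\<lambda>l. p (l + i) / p l) \<longlonglongrightarrow> r ^ i" for i
  proof (induction i)
    case 0
    then show ?case using pos by (simp add: less_imp_neq[THEN not_sym])
  next
    case (Suc i)
    have "(\<lambda>l. \<rho> (l + i) * (p (l + i) / p l)) \<longlonglongrightarrow> r * r ^ i"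
      using LIMSEQ_ignore_initial_segment[OF lim] Suc by (intro tendsto_mult) auto
    moreover have "\<rho> (l + i) * (p (l + i) / p l) = p (l + Suc i) / p l" for l
      using pos[of "l + i"] by (simp add: \<rho>_def)
    ultimately show ?case by (simp only: power_Suc)
  qed
  \<comment> \<open>The recursion divided by \<open>p l\<close> becomes the characteristic equation in the limit.\<close>
  have "(\<lambda>l. p (l + d) / p l - e) \<longlonglongrightarrow> r ^ d - e"
    by (intro tendsto_intros shifted)
  moreover have "p (l + d) / p l - e = p (l + Suc d) / p l" for l
    using rec[of l] pos[of l] by (simp add: field_simps)
  ultimately have "r ^ Suc d = r ^ d - e"
    using shifted[of "Suc d"] by (simp add: LIMSEQ_unique)
  then have eq: "r ^ d * (1 - r) = e" by (simp add: algebra_simps)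
  have "0 \<le> r" using lim \<rho>_pos by (meson LIMSEQ_le_const less_imp_le)
  moreover have "r \<noteq> 0" using eq e by (cases d) auto
  moreover have "r \<le> 1" using lim \<rho>_le_1 by (meson LIMSEQ_le_const2)
  moreover have "r \<noteq> 1" using eq e by auto
  ultimately show thesis using that eq lim unfolding \<rho>_def by (metis less_eq_real_def)
qed

lemma geometric_lower:
  fixes b :: "nat \<Rightarrow> real"
  assumes "\<And>l. y * b l \<le> b (Suc l)" "0 \<le> y"
  shows "b 0 * y ^ h \<le> b h"
proof (induction h)
  case (Suc h)
  have "b 0 * y ^ Suc h = y * (b 0 * y ^ h)" by simp
  also have "\<dots> \<le> y * b h" using Suc assms by (intro mult_left_mono)
  also have "\<dots> \<le> b (Suc h)" by fact
  finally show ?case .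
qed simp

lemma geometric_upper:
  fixes p :: "nat \<Rightarrow> real"
  assumes "\<And>l. N \<le> l \<Longrightarrow> p (Suc l) \<le> x * p l" "\<And>l. p l \<le> 1" "0 < x" "x \<le> 1"
  shows "p h \<le> (1 / x) ^ N * x ^ h"
proof (cases "h \<le> N")
  case True
  then have "x ^ N \<le> x ^ h" using assms by (intro power_decreasing) auto
  then have "1 \<le> (1 / x) ^ N * x ^ h" using assms by (simp add: field_simps)
  then show ?thesis using assms(2)[of h] by linarith
next
  case False
  have "p (N + j) \<le> x ^ j" for j
  proof (induction j)
    case (Suc j)
    have "p (Suc (N + j)) \<le> x * p (N + j)" by (rule assms) simp
    also have "\<dots> \<le> x * x ^ j" using Suc assms by (intro mult_left_mono) auto
    finally show ?case by simp
  qed (use assms in simp)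
  from this[of "h - N"] False have "p h \<le> x ^ (h - N)" by simp
  also have "\<dots> = (1 / x) ^ N * x ^ h" using False assms by (simp add: power_diff field_simps)
  finally show ?thesis .
qed

text \<open>A strict inequality at \<open>r\<close> persists slightly to the right of \<open>r\<close>. The surplus \<open>y - r\<close> becomes the gap
  between the escape rates.\<close>

lemma exponent_above:
  fixes r e :: real
  assumes "0 < r" "r < 1" "e < r ^ p * (1 - r)"
  obtains y where "r < y" "y < 1" "e \<le> y ^ p * (1 - y)"
proof -
  have "((\<lambda>y. y ^ p * (1 - y)) \<longlongrightarrow> r ^ p * (1 - r)) (at_right r)"
    by (intro tendsto_intros)
  then have "eventually (\<lambda>y. e < y ^ p * (1 - y)) (at_right r)"
    using assms(3) order_tendstoD(1) by blast
  moreover have "eventually (\<lambda>y. r < y \<and> y < 1) (at_right r)"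
    using eventually_at_right_real[OF assms(2)] by simp
  ultimately have "eventually (\<lambda>y. e < y ^ p * (1 - y) \<and> r < y \<and> y < 1) (at_right r)"
    by (rule eventually_conj)
  then obtain y where "e < y ^ p * (1 - y) \<and> r < y \<and> y < 1"
    using eventually_happens[of _ "at_right r"] by auto
  then show thesis using that by auto
qed

section \<open>Exponential growth rates of submultiplicative sequences\<close>

text \<open>Fekete's subadditivity lemma with a linear lower bound, which makes the limit finite.\<close>

lemma fekete:
  fixes u :: "nat \<Rightarrow> real"
  assumes sub: "\<And>i j. u (i + j) \<le> u i + u j" and low: "\<And>i. - K * real i \<le> u i"
  shows "convergent (\<lambda>n. u n / real n)"
proof -
  define l where "l = (INF n\<in>{1..}. u n / real n)"
  have bdd: "bdd_below ((\<lambda>n. u n / real n) ` {1..})"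
  proof (rule bdd_belowI2)
    fix n :: nat assume "n \<in> {1..}"
    then show "- K \<le> u n / real n" using low[of n] by (simp add: field_simps)
  qed
  have lower: "l \<le> u n / real n" if "1 \<le> n" for n
    unfolding l_def using that bdd by (intro cINF_lower) auto
  have mult: "u (j * k + i) \<le> real j * u k + u i" for i j k
  proof (induction j)
    case (Suc j)
    have "u (Suc j * k + i) \<le> u k + u (j * k + i)"
      using sub[of k "j * k + i"] by (simp add: add.assoc)
    then show ?case using Suc by (simp add: algebra_simps)
  qed simp
  have "(\<lambda>n. u n / real n) \<longlonglongrightarrow> l"
  proof (rule LIMSEQ_I)
    fix \<epsilon> :: real assume "0 < \<epsilon>"
    have "\<exists>k\<in>{1..}. u k / real k < l + \<epsilon> / 2"
      using cINF_less_iff[OF _ bdd, of "l + \<epsilon> / 2"] \<open>0 < \<epsilon>\<close> by (auto simp: l_def)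
    then obtain k where k: "1 \<le> k" "u k / real k < l + \<epsilon> / 2" by auto
    define B where "B = (\<Sum>i<k. \<bar>u i - real i * (u k / real k)\<bar>)"
    have B: "u n \<le> real n * (u k / real k) + B" for n
    proof -
      \<comment> \<open>Division with remainder by the near-optimal index \<open>k\<close>; the remainder costs at most the constant \<open>B\<close>.\<close>
      have "u n \<le> real (n div k) * u k + u (n mod k)"
        using mult[of "n div k" k "n mod k"] by simp
      also have "real (n div k) * u k = (real n - real (n mod k)) * (u k / real k)"
      proof -
        have "real n = real (n div k) * real k + real (n mod k)"
          by (metis div_mult_mod_eq of_nat_add of_nat_mult)
        then show ?thesis using k by (simp add: field_simps)
      qed
      also have "\<dots> + u (n mod k) = real n * (u k / real k) + (u (n mod k) - real (n mod k) * (u k / real k))"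
        by (simp add: algebra_simps)
      also have "u (n mod k) - real (n mod k) * (u k / real k) \<le> B"
      proof -
        have "\<bar>u (n mod k) - real (n mod k) * (u k / real k)\<bar> \<le> B"
          unfolding B_def using k by (intro member_le_sum[where f = "\<lambda>i. \<bar>u i - real i * (u k / real k)\<bar>"]) auto
        then show ?thesis by linarith
      qed
      finally show ?thesis by simp
    qed
    obtain M where M: "2 * B / \<epsilon> < real M" using reals_Archimedean2 by blast
    show "\<exists>no. \<forall>n\<ge>no. norm (u n / real n - l) < \<epsilon>"
    proof (intro exI allI impI)
      fix n assume n: "max 1 M \<le> n"
      have "2 * B / \<epsilon> < real n" using M n by (meson less_le_trans max.boundedE of_nat_le_iff)
      then have "B / real n < \<epsilon> / 2" using \<open>0 < \<epsilon>\<close> n by (simp add: field_simps)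
      moreover have "u n / real n \<le> u k / real k + B / real n"
        using B[of n] n by (simp add: field_simps)
      ultimately have "u n / real n < l + \<epsilon>" using k by linarith
      moreover have "l \<le> u n / real n" using lower n by auto
      ultimately show "norm (u n / real n - l) < \<epsilon>" by auto
    qed
  qed
  then show ?thesis by (rule convergentI)
qed

text \<open>The offset \<open>L\<close> is the length of the hole words: survival up to time \<open>h\<close> is decided by the first
  \<open>h + L\<close> symbols.\<close>

definition growth_exponent :: "(nat \<Rightarrow> real) \<Rightarrow> nat \<Rightarrow> nat \<Rightarrow> ereal" where
  "growth_exponent a L h = ereal (1 / real h) * ln_ext (a (h + L))"

text \<open>A submultiplicative sequence with a zero vanishes from then on, and its exponent is \<open>- \<infinity>\<close>. Otherwise
  the logarithms satisfy Fekete's lemma, and the offset \<open>L\<close> disappears in the limit.\<close>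

lemma growth_exponent_convergent:
  assumes sub: "\<And>i j. a (i + j) \<le> a i * a j" and nonneg: "\<And>i. 0 \<le> a i"
    and low: "\<And>i. a i \<noteq> 0 \<Longrightarrow> \<beta> ^ i \<le> a i" and "0 < \<beta>"
  shows "convergent (growth_exponent a L)"
proof (cases "\<exists>l. a l = 0")
  case True
  then obtain l where l: "a l = 0" by blast
  have "a (l + j) = 0" for j using sub[of l j] nonneg[of "l + j"] l by simp
  then have z: "a i = 0" if "l \<le> i" for i using that by (metis le_Suc_ex)
  have "growth_exponent a L h = - \<infinity>" if "Suc l \<le> h" for h
    using that by (simp add: growth_exponent_def z ln_ext_def)
  then have "eventually (\<lambda>h. growth_exponent a L h = - \<infinity>) sequentially"
    by (auto intro: eventually_sequentiallyI)
  then show ?thesis by (rule convergentI[OF tendsto_eventually])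
next
  case False
  then have pos: "0 < a i" for i using nonneg[of i] by (metis less_eq_real_def)
  have "convergent (\<lambda>n. ln (a n) / real n)"
  proof (rule fekete[where K = "- ln \<beta>"])
    fix i j
    have "ln (a (i + j)) \<le> ln (a i * a j)" using sub pos by simp
    then show "ln (a (i + j)) \<le> ln (a i) + ln (a j)" using pos by (simp add: ln_mult_pos)
    have "ln (\<beta> ^ i) \<le> ln (a i)" using low[of i] False pos \<open>0 < \<beta>\<close> by (subst ln_le_cancel_iff) auto
    then show "- (- ln \<beta>) * real i \<le> ln (a i)" using \<open>0 < \<beta>\<close> by (simp add: ln_realpow mult.commute)
  qed
  then obtain l where l: "(\<lambda>n. ln (a n) / real n) \<longlonglongrightarrow> l" by (auto simp: convergent_def)
  have "(\<lambda>h. (1 + real L * (1 / real h)) * (ln (a (h + L)) / real (h + L))) \<longlonglongrightarrow> (1 + real L * 0) * l"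
    by (intro tendsto_intros LIMSEQ_ignore_initial_segment[OF l] lim_1_over_n)
  moreover have "eventually (\<lambda>h. (1 + real L * (1 / real h)) * (ln (a (h + L)) / real (h + L)) = 1 / real h * ln (a (h + L))) sequentially"
    using eventually_gt_at_top[of 0]
  proof eventually_elim
    case (elim h)
    then have "1 + real L * (1 / real h) = real (h + L) / real h" by (simp add: field_simps)
    then show ?case using elim by simp
  qed
  ultimately have "(\<lambda>h. 1 / real h * ln (a (h + L))) \<longlonglongrightarrow> l"
    using Lim_transform_eventually by fastforce
  then have "(\<lambda>h. ereal (1 / real h * ln (a (h + L)))) \<longlonglongrightarrow> ereal l" by simp
  moreover have "growth_exponent a L h = ereal (1 / real h * ln (a (h + L)))" for h
    using False by (simp add: growth_exponent_def ln_ext_def)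
  ultimately have "growth_exponent a L \<longlonglongrightarrow> ereal l" by presburger
  then show ?thesis by (rule convergentI)
qed

lemma exponent_of_geometric:
  fixes c x :: real
  assumes "0 < c" "0 < x"
  shows "(\<lambda>h. ereal (1 / real h * ln (c * x ^ h))) \<longlonglongrightarrow> ereal (ln x)"
proof -
  have "(\<lambda>h. ln c * (1 / real h) + ln x) \<longlonglongrightarrow> ln c * 0 + ln x"
    by (intro tendsto_intros lim_1_over_n)
  moreover have "eventually (\<lambda>h. ln c * (1 / real h) + ln x = 1 / real h * ln (c * x ^ h)) sequentially"
    using eventually_gt_at_top[of 0]
    by eventually_elim (use assms in \<open>simp add: ln_mult_pos ln_realpow field_simps\<close>)
  ultimately have "(\<lambda>h. 1 / real h * ln (c * x ^ h)) \<longlonglongrightarrow> ln x"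
    using Lim_transform_eventually by fastforce
  then show ?thesis by simp
qed

lemma growth_exponent_ge:
  assumes "0 < c" "0 < y" "\<And>h. c * y ^ h \<le> a h" "convergent (growth_exponent a L)"
  shows "ereal (ln y) \<le> lim (growth_exponent a L)"
proof (rule LIMSEQ_le)
  show "(\<lambda>h. ereal (1 / real h * ln (c * y ^ L * y ^ h))) \<longlonglongrightarrow> ereal (ln y)"
    using assms by (intro exponent_of_geometric) auto
  show "growth_exponent a L \<longlonglongrightarrow> lim (growth_exponent a L)"
    using assms(4) by (simp add: convergent_LIMSEQ_iff)
  have "ereal (1 / real h * ln (c * y ^ L * y ^ h)) \<le> growth_exponent a L h" for h
  proof -
    have "c * y ^ L * y ^ h \<le> a (h + L)" using assms(3)[of "h + L"] by (simp add: power_add ac_simps)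
    moreover have "0 < c * y ^ L * y ^ h" using assms by simp
    ultimately show ?thesis
      by (auto simp: growth_exponent_def ln_ext_def intro!: mult_left_mono divide_right_mono)
  qed
  then show "\<exists>N. \<forall>n\<ge>N. ereal (1 / real n * ln (c * y ^ L * y ^ n)) \<le> growth_exponent a L n" by blast
qed

lemma growth_exponent_le:
  assumes "0 < c" "0 < x" "\<And>h. a h \<le> c * x ^ h" "\<And>h. 0 \<le> a h" "convergent (growth_exponent a L)"
  shows "lim (growth_exponent a L) \<le> ereal (ln x)"
proof (rule LIMSEQ_le)
  show "(\<lambda>h. ereal (1 / real h * ln (c * x ^ L * x ^ h))) \<longlonglongrightarrow> ereal (ln x)"
    using assms by (intro exponent_of_geometric) auto
  show "growth_exponent a L \<longlonglongrightarrow> lim (growth_exponent a L)"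
    using assms(5) by (simp add: convergent_LIMSEQ_iff)
  have "growth_exponent a L h \<le> ereal (1 / real h * ln (c * x ^ L * x ^ h))" if "1 \<le> h" for h
  proof -
    have *: "a (h + L) \<le> c * x ^ L * x ^ h" using assms(3)[of "h + L"] by (simp add: power_add ac_simps)
    show ?thesis
    proof (cases "a (h + L) = 0")
      case True
      then show ?thesis using that by (simp add: growth_exponent_def ln_ext_def)
    next
      case False
      then have "0 < a (h + L)" using assms(4) by (metis less_eq_real_def)
      then show ?thesis using * False
        by (auto simp: growth_exponent_def ln_ext_def intro!: mult_left_mono divide_right_mono)
    qed
  qed
  then show "\<exists>N. \<forall>n\<ge>N. growth_exponent a L n \<le> ereal (1 / real n * ln (c * x ^ L * x ^ n))" by blast
qed

section \<open>Probability of avoiding a set of words\<close>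

definition avoidance_prob :: "'a set \<Rightarrow> 'a list set \<Rightarrow> nat \<Rightarrow> real" where
  "avoidance_prob A W l = real (card (avoiders A W l)) / real (card A) ^ l"

lemma avoidance_prob_nonneg: "0 \<le> avoidance_prob A W l"
  by (simp add: avoidance_prob_def)

context
  fixes A :: "'a set"
  assumes A: "finite A" "A \<noteq> {}"
begin

lemma card_alphabet_pos: "0 < real (card A)"
  using A by (simp add: card_gt_0_iff)

lemma avoidance_prob_Suc:
  "avoidance_prob A W (Suc l) =
     avoidance_prob A W l - real (card (first_hits A W (Suc l))) / real (card A) ^ Suc l"
proof -
  have "real (card (avoiders A W (Suc l))) + real (card (first_hits A W (Suc l)))
      = real (card A) * real (card (avoiders A W l))"
    using card_avoiders_Suc[OF A(1), of W l] by (metis of_nat_add of_nat_mult)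
  then have "real (card (avoiders A W (Suc l))) =
      real (card A) * real (card (avoiders A W l)) - real (card (first_hits A W (Suc l)))" by linarith
  then show ?thesis using card_alphabet_pos by (simp add: avoidance_prob_def diff_divide_distrib)
qed

lemma avoidance_prob_antimono: "i \<le> j \<Longrightarrow> avoidance_prob A W j \<le> avoidance_prob A W i"
  by (rule lift_Suc_antimono_le) (simp_all add: avoidance_prob_Suc)

lemma avoidance_prob_add:
  "avoidance_prob A W (i + j) \<le> avoidance_prob A W i * avoidance_prob A W j"
proof -
  have "real (card (avoiders A W (i + j))) \<le> real (card (avoiders A W i)) * real (card (avoiders A W j))"
    using card_avoiders_add[OF A(1), of W i j] by (metis of_nat_le_iff of_nat_mult)
  then show ?thesis using card_alphabet_pos
    by (simp add: avoidance_prob_def power_add divide_right_mono)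
qed

text \<open>The probability is a multiple of \<open>1 / card A ^ l\<close>, so it cannot be positive and smaller.\<close>

lemma avoidance_prob_ge:
  assumes "avoidance_prob A W l \<noteq> 0"
  shows "(1 / real (card A)) ^ l \<le> avoidance_prob A W l"
proof -
  have "1 \<le> real (card (avoiders A W l))" using assms by (cases "card (avoiders A W l)") (auto simp: avoidance_prob_def)
  then show ?thesis using card_alphabet_pos
    by (simp add: avoidance_prob_def power_one_over divide_right_mono)
qed

lemma avoidance_prob_short:
  assumes "\<And>u. u \<in> W \<Longrightarrow> length u = n" "l < n"
  shows "avoidance_prob A W l = 1"
proof -
  have "avoiders A W l = {v. set v \<subseteq> A \<and> length v = l}" using assms by (rule avoiders_short)
  then show ?thesis using card_lists_length_eq[OF A(1), of l] card_alphabet_pos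
    by (simp add: avoidance_prob_def)
qed

lemma avoidance_prob_le_1: "avoidance_prob A W l \<le> 1"
proof -
  have "avoidance_prob A W l \<le> avoidance_prob A W 0" by (rule avoidance_prob_antimono) simp
  also have "\<dots> \<le> 1" 
  proof -
    have "avoiders A W 0 \<subseteq> {[]}" by (auto simp: avoiders_def)
    then have "card (avoiders A W 0) \<le> 1" using card_mono[of "{[]}" "avoiders A W 0"] by simp
    then show ?thesis by (simp add: avoidance_prob_def)
  qed
  finally show ?thesis .
qed

lemma growth_exponent_avoidance_convergent: "convergent (growth_exponent (avoidance_prob A W) L)"
  by (rule growth_exponent_convergent[where \<beta> = "1 / real (card A)"])
    (use avoidance_prob_add avoidance_prob_nonneg avoidance_prob_ge card_alphabet_pos in auto)

text \<open>A constant word whose letter differs from the first letter of \<open>w\<close> avoids \<open>w\<close>.\<close>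

lemma avoidance_prob_single_pos:
  assumes "2 \<le> card A" "w \<noteq> []"
  shows "0 < avoidance_prob A {w} l"
proof -
  have "\<not> A \<subseteq> {hd w}"
  proof
    assume "A \<subseteq> {hd w}"
    then have "card A \<le> card {hd w}" by (intro card_mono) auto
    then show False using assms by simp
  qed
  then obtain c where c: "c \<in> A" "c \<noteq> hd w" by auto
  have "\<not> occurs_at w (replicate l c) p" for p
  proof
    assume "occurs_at w (replicate l c) p"
    then have "p + length w \<le> l" "replicate l c ! (p + 0) = w ! 0"
      using assms by (auto simp only: occurs_at_def length_replicate length_greater_0_conv)
    moreover have "0 < length w" using assms by simp
    ultimately show False using c by (simp add: hd_conv_nth)
  qed
  then have "replicate l c \<in> avoiders A {w} l"
    using c by (auto simp: avoiders_def avoids_def)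
  then have "0 < card (avoiders A {w} l)" using finite_avoiders[OF A(1)] by (auto simp: card_gt_0_iff)
  then show ?thesis using card_alphabet_pos by (simp add: avoidance_prob_def)
qed

lemma avoidance_prob_uncorrelated:
  assumes "\<And>u. u \<in> W \<Longrightarrow> length u = Suc d \<and> set u \<subseteq> A"
    and "\<And>u v l. u \<in> W \<Longrightarrow> v \<in> W \<Longrightarrow> 0 < l \<Longrightarrow> l < Suc d \<Longrightarrow> \<not> overlap_agrees u v l"
  shows "avoidance_prob A W (Suc (l + d)) = avoidance_prob A W (l + d)
           - real (card W) / real (card A) ^ Suc d * avoidance_prob A W l"
proof -
  have "card (first_hits A W (l + Suc d)) = card (avoiders A W l) * card W"
    using assms by (intro card_first_hits_uncorrelated) auto
  then have "real (card (first_hits A W (Suc (l + d)))) / real (card A) ^ Suc (l + d) =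
      real (card W) / real (card A) ^ Suc d * avoidance_prob A W l"
    using card_alphabet_pos by (simp add: avoidance_prob_def power_add field_simps)
  then show ?thesis by (simp add: avoidance_prob_Suc)
qed

lemma avoidance_prob_single_lower:
  assumes "length w = Suc d"
  shows "avoidance_prob A {w} (l + d) - (1 / real (card A)) ^ Suc d * avoidance_prob A {w} l
         \<le> avoidance_prob A {w} (Suc (l + d))"
proof -
  have "card (first_hits A {w} (l + Suc d)) \<le> card (avoiders A {w} l)"
    using assms A by (intro card_first_hits_single) auto
  then have "real (card (first_hits A {w} (Suc (l + d)))) / real (card A) ^ Suc (l + d) \<le>
      real (card (avoiders A {w} l)) / real (card A) ^ Suc (l + d)"
    using card_alphabet_pos by (intro divide_right_mono) auto
  also have "\<dots> = (1 / real (card A)) ^ Suc d * avoidance_prob A {w} l"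
    using card_alphabet_pos by (simp add: avoidance_prob_def power_add field_simps)
  finally show ?thesis by (simp add: avoidance_prob_Suc)
qed

text \<open>The overlap bound for first hits, with both terms rewritten as decrements of the avoidance
  probability.\<close>

lemma avoidance_prob_overlap_lower:
  fixes w :: "'a list"
  defines "a \<equiv> avoidance_prob A {w}"
  assumes "length w = Suc d" "0 < t" "t < Suc d" "overlap_agrees w w t"
  shows "a (l + d) + (1 / real (card A)) ^ t * a (l + d - t) - (1 / real (card A)) ^ Suc d * a l
         \<le> a (Suc (l + d)) + (1 / real (card A)) ^ t * a (Suc (l + d) - t)"
proof -
  let ?q = "real (card A)" and ?F = "\<lambda>l. real (card (first_hits A {w} l))"
  have "card (first_hits A {w} (l + Suc d)) + card (first_hits A {w} (l + Suc d - t)) \<le> card (avoiders A {w} l)"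
    using assms A by (intro card_first_hits_overlap) auto
  then have "?F (Suc (l + d)) + ?F (Suc (l + d) - t) \<le> real (card (avoiders A {w} l))"
    by (metis add_Suc_right of_nat_add of_nat_le_iff)
  then have "(?F (Suc (l + d)) + ?F (Suc (l + d) - t)) / ?q ^ Suc (l + d) \<le>
      real (card (avoiders A {w} l)) / ?q ^ Suc (l + d)"
    using card_alphabet_pos by (intro divide_right_mono) auto
  also have "\<dots> = (1 / ?q) ^ Suc d * a l"
    using card_alphabet_pos by (simp add: a_def avoidance_prob_def power_add field_simps)
  finally have "?F (Suc (l + d)) / ?q ^ Suc (l + d) + ?F (Suc (l + d) - t) / ?q ^ Suc (l + d) \<le> (1 / ?q) ^ Suc d * a l"
    by (simp add: add_divide_distrib)
  moreover have "?F (Suc (l + d) - t) / ?q ^ Suc (l + d) = (1 / ?q) ^ t * (a (l + d - t) - a (Suc (l + d) - t))"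
  proof -
    have S: "Suc (l + d) - t = Suc (l + d - t)" using assms by simp
    have "?q ^ Suc (l + d) = ?q ^ t * ?q ^ Suc (l + d - t)"
      using assms by (simp add: power_add[symmetric] del: power_Suc)
    then show ?thesis unfolding S a_def avoidance_prob_Suc using card_alphabet_pos
      by (simp add: power_one_over)
  qed
  moreover have "?F (Suc (l + d)) / ?q ^ Suc (l + d) = a (l + d) - a (Suc (l + d))"
    unfolding a_def avoidance_prob_Suc by simp
  ultimately show ?thesis by (simp add: algebra_simps)
qed

text \<open>Let \<open>r\<close> be the decay rate of avoidance for an overlap-free set of words of length \<open>m\<close> whose total
  probability is that of \<open>w\<close>. The rate for \<open>w\<close> is strictly larger: either the delay \<open>n\<close> is shorter than \<open>m\<close>,
  or an overlap of \<open>w\<close> reduces the loss.\<close>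

lemma avoidance_prob_beats_rate:
  assumes "length w = n" "0 < n" "n \<le> m"
    and neq: "n < m \<or> (\<exists>t. 0 < t \<and> t < n \<and> overlap_agrees w w t)"
    and r: "0 < r" "r < 1" "r ^ (m - 1) * (1 - r) = (1 / real (card A)) ^ n"
  obtains y c where "r < y" "y < 1" "0 < c" "\<And>h. c * y ^ h \<le> avoidance_prob A {w} h"
proof (cases "n < m")
  case True
  let ?a = "avoidance_prob A {w}"
  obtain d where d: "n = Suc d" using \<open>0 < n\<close> by (cases n) auto
  have "r ^ (m - 1) < r ^ d" using True d r by (intro power_strict_decreasing) auto
  then have "(1 / real (card A)) ^ n < r ^ d * (1 - r)" using r by (metis diff_gt_0_iff_gt mult_strict_right_mono)
  then obtain y where y: "r < y" "y < 1" "(1 / real (card A)) ^ n \<le> y ^ d * (1 - y)"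
    by (rule exponent_above[OF r(1,2)])
  have "y * ?a l \<le> ?a (Suc l)" for l
  proof (rule ratio_lower_bound[OF _ _ y(3)])
    show "?a l \<le> ?a (Suc l)" if "l < d" for l
      using that assms(1) d by (subst (1 2) avoidance_prob_short[of _ n]) auto
    show "?a (l + d) - (1 / real (card A)) ^ n * ?a l \<le> ?a (Suc (l + d))" for l
      using avoidance_prob_single_lower[of w d l] assms(1) d by simp
  qed (use y r avoidance_prob_nonneg in auto)
  then have "?a 0 * y ^ h \<le> ?a h" for h using geometric_lower[of y ?a] y r by auto
  moreover have "?a 0 = 1" using assms by (intro avoidance_prob_short[of _ n]) auto
  ultimately show thesis using that[of y 1] y by simp
next
  case False
  let ?a = "avoidance_prob A {w}" and ?q = "real (card A)"
  from False \<open>n \<le> m\<close> have [simp]: "m = n" by simp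
  from neq obtain t where t: "0 < t" "t < n" "overlap_agrees w w t" by auto
  obtain d where d: "n = Suc d" using \<open>0 < n\<close> by (cases n) auto
  define g where "g = (1 / ?q) ^ t"
  have g: "0 < g" using card_alphabet_pos by (simp add: g_def)
  \<comment> \<open>Since \<open>?a\<close> decreases, \<open>b l \<ge> (1 + g) * ?a l\<close>, so the loss \<open>(1 / ?q) ^ n * ?a l\<close> is at most
    \<open>e * b l\<close> with this smaller constant.\<close>
  define e where "e = (1 / ?q) ^ n / (1 + g)"
  have "X / (1 + g) < X" if "0 < X" for X using that g by (simp add: field_simps)
  then have "e < (1 / ?q) ^ n" using card_alphabet_pos by (simp add: e_def)
  then have "e < r ^ d * (1 - r)" using r d by simp
  then obtain y where y: "r < y" "y < 1" "e \<le> y ^ d * (1 - y)"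
    by (rule exponent_above[OF r(1,2)])
  \<comment> \<open>The difference \<open>l - t\<close> is truncated only for \<open>l < t\<close>, where \<open>?a\<close> is still constantly \<open>1\<close>.\<close>
  define b where "b l = ?a l + g * ?a (l - t)" for l
  have short: "?a l = 1" if "l < n" for l
    using that assms(1) by (intro avoidance_prob_short[of _ n]) auto
  have "y * b l \<le> b (Suc l)" for l
  proof (rule ratio_lower_bound[OF _ _ y(3)])
    show "b l \<le> b (Suc l)" if "l < d" for l
      using that d by (simp add: b_def short)
    show "b (l + d) - e * b l \<le> b (Suc (l + d))" for l
    proof -
      have "(1 + g) * ?a l \<le> b l"
        using avoidance_prob_antimono[of "l - t" l] g by (simp add: b_def algebra_simps)
      then have "e * ((1 + g) * ?a l) \<le> e * b l"
        using g by (intro mult_left_mono) (auto simp: e_def)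
      moreover have "e * ((1 + g) * ?a l) = (1 / ?q) ^ n * ?a l" using g by (simp add: e_def)
      ultimately show ?thesis
        using avoidance_prob_overlap_lower[of w d t l] t d assms(1) by (simp add: b_def g_def)
    qed
  qed (use y r g avoidance_prob_nonneg in \<open>auto simp: b_def intro!: add_nonneg_nonneg mult_nonneg_nonneg\<close>)
  then have b: "b 0 * y ^ h \<le> b h" for h using geometric_lower[of y b] y r by auto
  have "y ^ t * y ^ h \<le> ?a h" for h
  proof -
    have "(1 + g) * y ^ (h + t) \<le> b (h + t)" using b[of "h + t"] short[of 0] \<open>0 < n\<close> by (simp add: b_def)
    also have "\<dots> \<le> (1 + g) * ?a h" 
      using avoidance_prob_antimono[of h "h + t"] by (simp add: b_def algebra_simps)
    finally show ?thesis using g by (simp add: power_add mult.commute)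
  qed
  then show thesis using that[of y "y ^ t"] y r by simp
qed

text \<open>The overlap-free set either cannot be avoided for ever, and then its exponent lies below that of every
  geometric sequence, or it is avoided with the rate \<open>r\<close> from \<open>ratio_limit\<close>.\<close>

lemma growth_exponent_avoidance_less:
  assumes "2 \<le> card A" "length w = n" "0 < n" "n \<le> m"
    and neq: "n < m \<or> (\<exists>t. 0 < t \<and> t < n \<and> overlap_agrees w w t)"
    and W: "\<And>u. u \<in> W \<Longrightarrow> length u = m \<and> set u \<subseteq> A" "card W = card A ^ (m - n)"
    and unc: "\<And>u v l. u \<in> W \<Longrightarrow> v \<in> W \<Longrightarrow> 0 < l \<Longrightarrow> l < m \<Longrightarrow> \<not> overlap_agrees u v l"
  shows "lim (growth_exponent (avoidance_prob A W) m) < lim (growth_exponent (avoidance_prob A {w}) n)"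
proof -
  let ?a = "avoidance_prob A {w}" and ?p = "avoidance_prob A W" and ?q = "real (card A)"
  have "\<exists>x y c N. 0 < x \<and> x < y \<and> y < 1 \<and> 0 < c \<and> (\<forall>h. c * y ^ h \<le> ?a h) \<and> (\<forall>l\<ge>N. ?p (Suc l) \<le> x * ?p l)"
  proof (cases "\<exists>l. ?p l = 0")
    case True
    then obtain N where N: "?p N = 0" by blast
    have "?p l = 0" if "N \<le> l" for l
      using avoidance_prob_antimono[OF that, of W] avoidance_prob_nonneg[of A W l] N by simp
    \<comment> \<open>Any factor below \<open>1 / ?q\<close> separates the zero tail from the trivial bound \<open>(1 / ?q) ^ h\<close> for \<open>w\<close>.\<close>
    then have "\<forall>l\<ge>N. ?p (Suc l) \<le> 1 / (2 * ?q) * ?p l" by simp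
    moreover have "1 * (1 / ?q) ^ h \<le> ?a h" for h
    proof -
      have "w \<noteq> []" using assms by auto
      then have "?a h \<noteq> 0" using avoidance_prob_single_pos[OF assms(1), of w h] by simp
      then show ?thesis using avoidance_prob_ge[of "{w}" h] by simp
    qed
    moreover have "0 < 1 / (2 * ?q)" "1 / (2 * ?q) < 1 / ?q" "1 / ?q < 1" using assms(1) by (auto simp: field_simps)
    ultimately show ?thesis using zero_less_one by blast
  next
    case False
    then have pos: "0 < ?p l" for l using avoidance_prob_nonneg[of A W l] by (metis less_eq_real_def)
    obtain d where d: "m = Suc d" using assms by (cases m) auto
    have e: "real (card W) / ?q ^ m = (1 / ?q) ^ n"
    proof -
      have "?q ^ m = ?q ^ n * ?q ^ (m - n)" using \<open>n \<le> m\<close> by (simp add: power_add[symmetric])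
      then show ?thesis using card_alphabet_pos by (simp add: W(2) power_one_over)
    qed
    have rec: "?p (Suc (l + d)) = ?p (l + d) - (1 / ?q) ^ n * ?p l" for l
      using avoidance_prob_uncorrelated[of W d l] W(1) unc unfolding d[symmetric] e by blast
    have "(1 / ?q) ^ n < 1" using assms(1) \<open>0 < n\<close> power_strict_decreasing[of 0 n "1 / ?q"] by simp
    moreover have "?p l = 1" if "l \<le> d" for l
      using that W(1) d by (intro avoidance_prob_short[of _ m]) auto
    moreover have "0 < (1 / ?q) ^ n" using card_alphabet_pos by simp
    ultimately obtain r where r: "0 < r" "r < 1" "r ^ d * (1 - r) = (1 / ?q) ^ n"
        "(\<lambda>l. ?p (Suc l) / ?p l) \<longlonglongrightarrow> r"
      using ratio_limit[of ?p "(1 / ?q) ^ n" d] pos rec by metis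
    then obtain y c where y: "r < y" "y < 1" "0 < c" "\<And>h. c * y ^ h \<le> ?a h"
      using avoidance_prob_beats_rate[OF assms(2-5), of r] d by auto
    have "eventually (\<lambda>l. ?p (Suc l) / ?p l < (r + y) / 2) sequentially"
      using y by (intro order_tendstoD[OF r(4)]) auto
    then obtain N where "\<And>l. N \<le> l \<Longrightarrow> ?p (Suc l) / ?p l < (r + y) / 2"
      by (auto simp: eventually_sequentially)
    then have "\<forall>l\<ge>N. ?p (Suc l) \<le> (r + y) / 2 * ?p l" using pos by (simp add: pos_divide_less_eq less_imp_le)
    moreover have "0 < (r + y) / 2" "(r + y) / 2 < y" using r y by auto
    ultimately show ?thesis using y by blast
  qed
  then obtain x y c N where x: "0 < x" "x < y" "y < 1" "0 < c" "\<And>h. c * y ^ h \<le> ?a h"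
      "\<And>l. N \<le> l \<Longrightarrow> ?p (Suc l) \<le> x * ?p l" by blast
  have "lim (growth_exponent ?p m) \<le> ereal (ln x)"
    using geometric_upper[of N ?p x] x avoidance_prob_le_1 avoidance_prob_nonneg
      growth_exponent_avoidance_convergent
    by (intro growth_exponent_le[of "(1 / x) ^ N"]) auto
  also have "\<dots> < ereal (ln y)" using x by simp
  also have "\<dots> \<le> lim (growth_exponent ?a n)"
    using x growth_exponent_avoidance_convergent by (intro growth_exponent_ge[of c]) auto
  finally show ?thesis .
qed

end

section \<open>Itineraries of an expansive interval map\<close>

text \<open>By the mean value theorem \<open>g\<close> is injective on the interval, hence monotone.\<close>

lemma between_endpoints_if_deriv_nonzero:
  fixes g :: "real \<Rightarrow> real"
  assumes der: "\<And>x. a \<le> x \<Longrightarrow> x \<le> b \<Longrightarrow> (g has_real_derivative g' x) (at x)"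
    and nz: "\<And>x. a \<le> x \<Longrightarrow> x \<le> b \<Longrightarrow> g' x \<noteq> 0" and y: "a \<le> y" "y \<le> b"
  shows "g y \<in> closed_segment (g a) (g b)"
proof (cases "a < y \<and> y < b")
  case True
  have "continuous_on {a..b} g"
    using der by (intro continuous_at_imp_continuous_on ballI DERIV_isCont[of g "g' _"]) auto
  moreover have "inj_on g {a..b}"
  proof (rule linorder_inj_onI)
    fix x z assume "x < z" "x \<in> {a..b}" "z \<in> {a..b}"
    then obtain u where "x < u" "u < z" "g z - g x = (z - x) * g' u"
      using MVT2[of x z g g'] der by auto
    then show "g x \<noteq> g z" using nz[of u] \<open>x < z\<close> \<open>x \<in> _\<close> \<open>z \<in> _\<close> by auto
  qed auto
  ultimately show ?thesis
    using continuous_inj_imp_mono[of a y b g] True by (auto simp: closed_segment_eq_real_ivl)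
qed (use y in auto)

text \<open>Only membership in the interiors of the prescribed cells is recorded, so that points with different
  itineraries are separated.\<close>

definition cell_itinerary :: "(real \<Rightarrow> real) \<Rightarrow> real set list \<Rightarrow> real set" where
  "cell_itinerary g Js = {x. \<forall>j<length Js. (g ^^ j) x \<in> interior (Js ! j)}"

lemma cell_itinerary_Cons:
  "cell_itinerary g (J # Js) = {x \<in> interior J. g x \<in> cell_itinerary g Js}"
  by (auto simp: cell_itinerary_def less_Suc_eq_0_disj funpow_swap1 simp del: funpow.simps
      simp add: funpow_Suc_right)

text \<open>Each branch of \<open>g\<close> is monotone, so pulling back an interval along a branch gives an interval.\<close>

lemma is_interval_cell_itinerary:
  assumes "\<And>J. J \<in> set Js \<Longrightarrow> is_interval (interior J)"
    and "\<And>J x. J \<in> set Js \<Longrightarrow> x \<in> interior J \<Longrightarrow> (g has_real_derivative g' x) (at x) \<and> g' x \<noteq> 0"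
  shows "is_interval (cell_itinerary g Js)"
  using assms
proof (induction Js)
  case Nil
  then show ?case by (simp add: cell_itinerary_def)
next
  case (Cons J Js)
  have IH: "is_interval (cell_itinerary g Js)" using Cons by auto
  have J: "is_interval (interior J)" using Cons by auto
  show ?case unfolding is_interval_1
  proof (intro ballI allI impI)
    fix a b y assume a: "a \<in> cell_itinerary g (J # Js)" and b: "b \<in> cell_itinerary g (J # Js)"
      and y: "a \<le> y \<and> y \<le> b"
    have in_J: "x \<in> interior J" if "a \<le> x" "x \<le> b" for x
      using J a b that unfolding is_interval_1 cell_itinerary_Cons by blast
    have "g y \<in> closed_segment (g a) (g b)"
      using in_J Cons.prems(2)[of J] y by (intro between_endpoints_if_deriv_nonzero[where g' = g']) auto
    moreover have "closed_segment (g a) (g b) \<subseteq> cell_itinerary g Js"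
      using IH a b by (intro closed_segment_subset) (auto simp: cell_itinerary_Cons is_interval_convex_1)
    ultimately show "y \<in> cell_itinerary g (J # Js)" using in_J y by (auto simp: cell_itinerary_Cons)
  qed
qed

lemma cell_itinerary_disjoint:
  assumes "length Js = length Ks" "Js \<noteq> Ks"
    and "\<And>J K. J \<in> set Js \<Longrightarrow> K \<in> set Ks \<Longrightarrow> J \<noteq> K \<Longrightarrow> interior J \<inter> interior K = {}"
  shows "cell_itinerary g Js \<inter> cell_itinerary g Ks = {}"
proof -
  obtain j where j: "j < length Js" "Js ! j \<noteq> Ks ! j"
    using assms(1,2) by (metis nth_equalityI)
  then have "interior (Js ! j) \<inter> interior (Ks ! j) = {}" using assms by auto
  then show ?thesis using j assms(1) by (auto simp: cell_itinerary_def)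
qed

text \<open>Disjoint intervals cannot both accumulate at a point from the same side. This is what
  limits the number of itineraries near a point.\<close>

definition accumulates_right :: "real \<Rightarrow> real set \<Rightarrow> bool" where
  "accumulates_right c K \<longleftrightarrow> (\<forall>e>0. \<exists>x\<in>K. c < x \<and> x < c + e)"

definition accumulates_left :: "real \<Rightarrow> real set \<Rightarrow> bool" where
  "accumulates_left c K \<longleftrightarrow> (\<forall>e>0. \<exists>x\<in>K. c - e < x \<and> x < c)"

lemma closure_real_cases:
  assumes "c \<in> closure K"
  shows "c \<in> K \<or> accumulates_right c K \<or> accumulates_left c K"
proof (rule ccontr)
  assume "\<not> ?thesis"
  then obtain d e where de: "0 < d" "0 < e" "c \<notin> K"
      "\<forall>x\<in>K. \<not> (c < x \<and> x < c + d)" "\<forall>x\<in>K. \<not> (c - e < x \<and> x < c)"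
    by (auto simp: accumulates_right_def accumulates_left_def)
  obtain x where x: "x \<in> K" "dist x c < min d e"
    using assms de by (metis closure_approachable min_less_iff_conj)
  then have "x \<noteq> c" using de by auto
  then show False using de x by (cases "x < c") (auto simp: dist_real_def)
qed

lemma accumulates_right_unique:
  assumes "is_interval K" "is_interval K'" "accumulates_right c K" "accumulates_right c K'"
  shows "K \<inter> K' \<noteq> {}"
proof -
  obtain x where x: "x \<in> K" "c < x" using assms(3)[unfolded accumulates_right_def, rule_format, of 1] by auto
  obtain y where y: "y \<in> K'" "c < y" "y < x"
    using assms(4)[unfolded accumulates_right_def, rule_format, of "x - c"] x by auto
  obtain z where z: "z \<in> K" "c < z" "z < y"
    using assms(3)[unfolded accumulates_right_def, rule_format, of "y - c"] y by auto
  have "y \<in> K" using assms(1) x y z unfolding is_interval_1 by (meson less_imp_le)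
  then show ?thesis using y by blast
qed

lemma accumulates_left_unique:
  assumes "is_interval K" "is_interval K'" "accumulates_left c K" "accumulates_left c K'"
  shows "K \<inter> K' \<noteq> {}"
proof -
  obtain x where x: "x \<in> K" "x < c" using assms(3)[unfolded accumulates_left_def, rule_format, of 1] by auto
  obtain y where y: "y \<in> K'" "x < y" "y < c"
    using assms(4)[unfolded accumulates_left_def, rule_format, of "c - x"] x by auto
  obtain z where z: "z \<in> K" "y < z" "z < c"
    using assms(3)[unfolded accumulates_left_def, rule_format, of "c - y"] y by auto
  have "y \<in> K" using assms(1) x y z unfolding is_interval_1 by (meson less_imp_le)
  then show ?thesis using y by blast
qed

lemma card_map_fibre:
  assumes "finite A" "\<And>J. card {a\<in>A. g a = J} \<le> B"
  shows "card {v. set v \<subseteq> A \<and> map g v = Js} \<le> B ^ length Js"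
proof (induction Js)
  case Nil
  have "{v. set v \<subseteq> A \<and> map g v = []} = {[]}" by auto
  then show ?case by simp
next
  case (Cons J Js)
  let ?S = "{v. set v \<subseteq> A \<and> map g v = Js}"
  have fin: "finite ?S"
    using finite_lists_length_eq[OF assms(1), of "length Js"] by (rule rev_finite_subset) auto
  have "{v. set v \<subseteq> A \<and> map g v = J # Js} \<subseteq> (\<lambda>(a, v). a # v) ` ({a\<in>A. g a = J} \<times> ?S)"
    by (auto simp: map_eq_Cons_conv)
  then have "card {v. set v \<subseteq> A \<and> map g v = J # Js} \<le> card ({a\<in>A. g a = J} \<times> ?S)"
    using fin assms(1) by (intro surj_card_le) auto
  also have "\<dots> \<le> B * B ^ length Js" unfolding card_cartesian_product
    by (intro mult_le_mono Cons assms)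
  finally show ?case by simp
qed

text \<open>The itinerary sets are intervals, and those with different cell sequences are disjoint. A point of
  such a closure is an element, a limit from the right or a limit from the left, and for each of these
  possibilities only one cell sequence is possible.\<close>

lemma card_words_near_point:
  fixes cell :: "'a \<Rightarrow> real set"
  assumes A: "finite A" "\<And>J. card {a\<in>A. cell a = J} \<le> B"
    and int: "\<And>a. a \<in> A \<Longrightarrow> is_interval (interior (cell a))"
    and der: "\<And>a x. a \<in> A \<Longrightarrow> x \<in> interior (cell a) \<Longrightarrow> (g has_real_derivative g' x) (at x) \<and> g' x \<noteq> 0"
    and disj: "\<And>a b. a \<in> A \<Longrightarrow> b \<in> A \<Longrightarrow> cell a \<noteq> cell b \<Longrightarrow> interior (cell a) \<inter> interior (cell b) = {}"
  shows "card {v. set v \<subseteq> A \<and> length v = n \<and> c \<in> closure (cell_itinerary g (map cell v))} \<le> 3 * B ^ n"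
proof -
  let ?K = "\<lambda>v. cell_itinerary g (map cell v)"
  let ?V = "\<lambda>Q. {v. set v \<subseteq> A \<and> length v = n \<and> Q (?K v)}"
  have interval: "is_interval (?K v)" if "set v \<subseteq> A" for v
    using that int der by (intro is_interval_cell_itinerary[where g' = g']) auto
  have bound: "card (?V Q) \<le> B ^ n"
    if Q: "\<And>K K'. is_interval K \<Longrightarrow> is_interval K' \<Longrightarrow> Q K \<Longrightarrow> Q K' \<Longrightarrow> K \<inter> K' \<noteq> {}" for Q
  proof (cases "?V Q = {}")
    case False
    then obtain u where u: "u \<in> ?V Q" by blast
    have "?V Q \<subseteq> {v. set v \<subseteq> A \<and> map cell v = map cell u}"
    proof clarify
      fix v assume v: "set v \<subseteq> A" "n = length v" "Q (?K v)"
      have "?K v \<inter> ?K u \<noteq> {}" using Q interval u v by auto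
      then show "map cell v = map cell u"
        using cell_itinerary_disjoint[of "map cell v" "map cell u" g] u v disj
        by (auto simp: subset_iff)
    qed
    moreover have "finite {v. set v \<subseteq> A \<and> map cell v = map cell u}"
      using finite_lists_length_eq[OF A(1), of "length u"]
      by (rule rev_finite_subset) (auto dest: map_eq_imp_length_eq)
    ultimately have "card (?V Q) \<le> card {v. set v \<subseteq> A \<and> map cell v = map cell u}"
      by (intro card_mono)
    also have "\<dots> \<le> B ^ n" using card_map_fibre[OF A, of "map cell u"] u by simp
    finally show ?thesis .
  next
    case True
    show ?thesis unfolding True by simp
  qed
  have "?V (\<lambda>K. c \<in> closure K) \<subseteq> ?V (\<lambda>K. c \<in> K) \<union> (?V (accumulates_right c) \<union> ?V (accumulates_left c))"
    using closure_real_cases by auto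
  then have "card (?V (\<lambda>K. c \<in> closure K)) \<le> card (?V (\<lambda>K. c \<in> K) \<union> (?V (accumulates_right c) \<union> ?V (accumulates_left c)))"
    by (intro card_mono finite_subset[OF _ finite_lists_length_eq[OF A(1), of n]]) auto
  also have "\<dots> \<le> card (?V (\<lambda>K. c \<in> K)) + (card (?V (accumulates_right c)) + card (?V (accumulates_left c)))"
    by (meson add_left_mono card_Un_le le_trans)
  also have "\<dots> \<le> B ^ n + (B ^ n + B ^ n)"
    by (intro add_mono bound)
      (auto dest: accumulates_right_unique[of _ _ c] accumulates_left_unique[of _ _ c])
  finally show ?thesis by simp
qed

lemma expansive_deriv:
  assumes "expansive_markov_map I \<P> g" "J \<in> \<P>" "x \<in> interior J"
  shows "(g has_real_derivative deriv g x) (at x)" "deriv g x \<noteq> 0"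
proof -
  have "((deriv ^^ 0) g) field_differentiable (at x)"
    using assms unfolding expansive_markov_map_def smooth_on_open_def by blast
  then show "(g has_real_derivative deriv g x) (at x)"
    by (simp add: DERIV_deriv_iff_field_differentiable)
  obtain c where "1 < c" "c \<le> \<bar>deriv g x\<bar>"
    using assms unfolding expansive_markov_map_def by blast
  then show "deriv g x \<noteq> 0" by auto
qed

text \<open>With a single cell, the mean value theorem would stretch the interval by a factor larger than one
  inside itself.\<close>

lemma expansive_two_cells:
  assumes g: "expansive_markov_map I \<P> g" and J: "J \<in> \<P>"
  shows "\<exists>K\<in>\<P>. K \<noteq> J"
proof (rule ccontr)
  assume "\<not> ?thesis"
  then have "\<P> = {J}" using J by blast
  then have "J = I" using g by (auto simp: expansive_markov_map_def markov_partition_def)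
  have "closed_interval J" using g J by (auto simp: expansive_markov_map_def markov_partition_def)
  then obtain a b where ab: "a < b" "J = {a..b}" by (auto simp: closed_interval_def)
  obtain c where c: "1 < c" "\<And>x. x \<in> interior J \<Longrightarrow> c \<le> \<bar>deriv g x\<bar>"
    using g J unfolding expansive_markov_map_def by blast
  \<comment> \<open>The derivative is controlled only inside \<open>(a, b)\<close>. Cutting off \<open>\<delta>\<close> on both sides leaves a length
    which, multiplied by \<open>c\<close>, still exceeds \<open>b - a\<close>.\<close>
  define \<delta> where "\<delta> = (b - a) * (c - 1) / (4 * c)"
  have \<delta>: "0 < \<delta>" "2 * \<delta> < b - a" "b - a < c * (b - a - 2 * \<delta>)"
  proof -
    show "0 < \<delta>" using ab c by (simp add: \<delta>_def)
    have e: "4 * (c * \<delta>) = (b - a) * (c - 1)" using c by (simp add: \<delta>_def)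
    have p: "0 < (b - a) * (c - 1)" using ab c by simp
    have "c * (2 * \<delta>) < c * (b - a)" using e p ab c by (simp add: algebra_simps)
    then show "2 * \<delta> < b - a" using c by simp
    show "b - a < c * (b - a - 2 * \<delta>)" using e p by (simp add: algebra_simps)
  qed
  have int: "interior J = {a<..<b}" using ab by simp
  obtain z where z: "a + \<delta> < z" "z < b - \<delta>" "g (b - \<delta>) - g (a + \<delta>) = (b - \<delta> - (a + \<delta>)) * deriv g z"
    using MVT2[of "a + \<delta>" "b - \<delta>" g "deriv g"] expansive_deriv(1)[OF g J] \<delta> int by auto
  have "b - a < (b - \<delta> - (a + \<delta>)) * c" using \<delta> by (simp add: algebra_simps)
  also have "\<dots> \<le> (b - \<delta> - (a + \<delta>)) * \<bar>deriv g z\<bar>"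
    using \<delta> z c int by (intro mult_left_mono) auto
  also have "\<dots> = \<bar>g (b - \<delta>) - g (a + \<delta>)\<bar>" using z(3) \<delta> by (simp add: abs_mult)
  also have "\<dots> \<le> b - a"
  proof -
    have "g x \<in> {a..b}" if "x \<in> {a..b}" for x
      using g \<open>J = I\<close> ab that by (auto simp: expansive_markov_map_def)
    from this[of "b - \<delta>"] this[of "a + \<delta>"] \<delta> show ?thesis by auto
  qed
  finally show False by simp
qed

text \<open>On the interiors of the cells the map is continuous, and the remaining points are finitely many end points.\<close>

lemma expansive_measurable:
  assumes g: "expansive_markov_map I \<P> g"
  shows "g \<in> measurable (restrict_space borel I) (restrict_space borel I)"
proof -
  have P: "finite \<P>" "\<Union>\<P> = I" "closed_interval I" "g ` I \<subseteq> I" "\<forall>J\<in>\<P>. closed_interval J"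
    using g by (auto simp: expansive_markov_map_def markov_partition_def)
  have I: "I \<in> sets borel" using P(3) by (auto simp: closed_interval_def)
  define E where "E = (\<Union>J\<in>\<P>. J - interior J)"
  have "finite (J - interior J)" if "J \<in> \<P>" for J
  proof -
    obtain a b where "a < b" "J = {a..b}" using P(5) \<open>J \<in> \<P>\<close> unfolding closed_interval_def by blast
    then have "J - interior J \<subseteq> {a, b}" by auto
    then show ?thesis by (rule finite_subset) simp
  qed
  then have E: "finite E" using P(1) by (simp add: E_def)
  have "g \<in> measurable (restrict_space borel I) borel"
  proof (rule measurableI)
    fix S :: "real set" assume S: "S \<in> sets borel"
    have "g -` S \<inter> interior J \<in> sets borel" if "J \<in> \<P>" for J
    proof -
      have "continuous_on (interior J) g"
        using expansive_deriv(1)[OF g that] by (intro continuous_at_imp_continuous_on) (auto intro: DERIV_isCont)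
      then have "g \<in> borel_measurable (restrict_space borel (interior J))"
        by (rule borel_measurable_continuous_on_restrict)
      from measurable_sets[OF this S] show ?thesis
        by (simp add: sets_restrict_space_iff space_restrict_space)
    qed
    moreover have "g -` S \<inter> E \<in> sets borel" using E by (intro borel_closed finite_imp_closed) auto
    ultimately have "(\<Union>J\<in>\<P>. g -` S \<inter> interior J) \<union> (g -` S \<inter> E) \<in> sets borel"
      by (intro sets.Un sets.finite_UN P(1)) auto
    moreover have "(\<Union>J\<in>\<P>. g -` S \<inter> interior J) \<union> (g -` S \<inter> E) = g -` S \<inter> I"
      using P(2) interior_subset unfolding E_def by blast
    ultimately show "g -` S \<inter> space (restrict_space borel I) \<in> sets (restrict_space borel I)"
      using I by (simp add: sets_restrict_space_iff space_restrict_space)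
  qed simp
  then show ?thesis using P(4) by (intro measurable_restrict_space2) (auto simp: space_restrict_space)
qed

section \<open>The Bernoulli measure on sequences\<close>

lemma shift_measure_prob_space: "0 < q \<Longrightarrow> prob_space (shift_measure q)"
  unfolding shift_measure_def
  by (intro prob_space.prob_space_stream_space prob_space_uniform_count_measure) auto

lemma space_shift_measure: "space (shift_measure q) = streams {..<q}"
  by (simp add: shift_measure_def space_stream_space space_uniform_count_measure)

lemma sets_shift_measure: "sets (shift_measure q) = sets (stream_space (count_space {..<q}))"
  unfolding shift_measure_def by (intro sets_stream_space_cong) (simp add: sets_uniform_count_measure)

lemma sstart_measurable: "set v \<subseteq> {..<q} \<Longrightarrow> sstart {..<q} v \<in> sets (shift_measure q)"
proof -
  assume "set v \<subseteq> {..<q}"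
  then have "v \<in> lists {..<q}" by auto
  moreover have "sstart ({..<q} :: nat set) ` lists {..<q} \<union> {{}} \<subseteq> Pow (streams {..<q})"
    using sstart_in_streams[of _ "{..<q}"] by blast
  ultimately show ?thesis
    unfolding sets_shift_measure sets_stream_space_sstart[OF countableI_type[of "{..<q}"]]
    by (subst sets_measure_of) (auto intro: sigma_sets.Basic)
qed

text \<open>Conditioning on the first symbol leaves the distribution of the remaining sequence unchanged.\<close>

lemma distr_shift_stl:
  assumes "0 < q"
  shows "distr (shift_measure q) (shift_measure q) stl = shift_measure q"
proof (rule measure_eqI)
  interpret U: prob_space "uniform_count_measure {..<q}"
    using assms by (intro prob_space_uniform_count_measure) auto
  have stl: "stl \<in> measurable (shift_measure q) (shift_measure q)"
    unfolding shift_measure_def by (rule measurable_stl)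
  fix X assume "X \<in> sets (distr (shift_measure q) (shift_measure q) stl)"
  then have X: "X \<in> sets (shift_measure q)" by simp
  let ?Y = "stl -` X \<inter> space (shift_measure q)"
  have Y: "?Y \<in> sets (shift_measure q)" using measurable_sets[OF stl X] .
  have "X \<subseteq> space (shift_measure q)" using sets.sets_into_space[OF X] .
  then have eq: "{x \<in> space (shift_measure q). t ## x \<in> ?Y} = X" if "t < q" for t
    using that by (auto simp: space_shift_measure)
  have "emeasure (distr (shift_measure q) (shift_measure q) stl) X = emeasure (shift_measure q) ?Y"
    by (rule emeasure_distr[OF stl X])
  also have "\<dots> = (\<integral>\<^sup>+t. emeasure (shift_measure q) {x \<in> space (shift_measure q). t ## x \<in> ?Y} \<partial>uniform_count_measure {..<q})"
    using Y unfolding shift_measure_def by (rule U.emeasure_stream_space)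
  also have "\<dots> = (\<integral>\<^sup>+t. emeasure (shift_measure q) X \<partial>uniform_count_measure {..<q})"
    by (rule nn_integral_cong) (subst eq, auto simp: space_uniform_count_measure)
  also have "\<dots> = emeasure (shift_measure q) X" using U.emeasure_space_1 by simp
  finally show "emeasure (distr (shift_measure q) (shift_measure q) stl) X = emeasure (shift_measure q) X" .
qed simp

lemma AE_shift_sdrop:
  assumes "0 < q" "AE s in shift_measure q. Q s"
  shows "AE s in shift_measure q. Q (sdrop j s)"
proof (induction j)
  case (Suc j)
  have stl: "stl \<in> measurable (shift_measure q) (shift_measure q)"
    unfolding shift_measure_def by (rule measurable_stl)
  have "AE s in distr (shift_measure q) (shift_measure q) stl. Q (sdrop j s)"
    unfolding distr_shift_stl[OF assms(1)] by (rule Suc)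
  from AE_distrD[OF stl this] show ?case by simp
qed (use assms in simp)

lemma sstart_iff_stake:
  "s \<in> streams S \<Longrightarrow> s \<in> sstart S v \<longleftrightarrow> stake (length v) s = v"
  by (auto simp: sstart_eq list_eq_iff_nth_eq)

lemma set_stake_subset: "s \<in> streams S \<Longrightarrow> set (stake l s) \<subseteq> S"
  by (auto simp: in_set_conv_nth streams_iff_snth)

text \<open>The cylinders of distinct words of equal length are disjoint and have equal measure.\<close>

lemma measure_prefix_set:
  assumes "0 < q" and V: "V \<subseteq> {v. set v \<subseteq> {..<q} \<and> length v = l}"
  shows "{s \<in> streams {..<q}. stake l s \<in> V} \<in> sets (shift_measure q)"
    and "measure (shift_measure q) {s \<in> streams {..<q}. stake l s \<in> V} = real (card V) / real q ^ l"
proof -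
  interpret M: prob_space "shift_measure q" using assms(1) by (rule shift_measure_prob_space)
  have fin: "finite V" using finite_lists_length_eq[of "{..<q}" l] V by (auto intro: finite_subset)
  have V': "length v = l" "set v \<subseteq> {..<q}" "v \<in> lists {..<q}" if "v \<in> V" for v using V that by auto
  have stake: "stake l s = v \<longleftrightarrow> s \<in> sstart {..<q} v" if "v \<in> V" "s \<in> streams {..<q}" for v s
    using sstart_iff_stake[OF that(2), of v] V'[OF that(1)] by simp
  have eq: "{s \<in> streams {..<q}. stake l s \<in> V} = (\<Union>v\<in>V. sstart {..<q} v)"
  proof (intro equalityI subsetI)
    fix s assume "s \<in> {s \<in> streams {..<q}. stake l s \<in> V}"
    then show "s \<in> (\<Union>v\<in>V. sstart {..<q} v)" using stake[of "stake l s" s] by auto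
  next
    fix s assume "s \<in> (\<Union>v\<in>V. sstart {..<q} v)"
    then obtain v where v: "v \<in> V" "s \<in> sstart {..<q} v" by auto
    then have "s \<in> streams {..<q}" using sstart_in_streams[OF V'(3)] by auto
    then show "s \<in> {s \<in> streams {..<q}. stake l s \<in> V}" using stake[OF v(1)] v by auto
  qed
  have meas: "sstart {..<q} ` V \<subseteq> sets (shift_measure q)" using sstart_measurable V' by auto
  have disj: "disjoint_family_on (sstart {..<q}) V"
    unfolding disjoint_family_on_def
  proof (intro ballI impI)
    fix u v assume uv: "u \<in> V" "v \<in> V" "u \<noteq> v"
    show "sstart {..<q} u \<inter> sstart {..<q} v = {}"
    proof (rule ccontr)
      assume "sstart {..<q} u \<inter> sstart {..<q} v \<noteq> {}"
      then obtain s where s: "s \<in> sstart {..<q} u" "s \<in> sstart {..<q} v" by auto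
      then have "s \<in> streams {..<q}" using sstart_in_streams[OF V'(3)[OF uv(1)]] by auto
      then show False using stake[of u s] stake[of v s] s uv by auto
    qed
  qed
  show "{s \<in> streams {..<q}. stake l s \<in> V} \<in> sets (shift_measure q)"
    unfolding eq using fin meas by (intro sets.finite_UN) auto
  have "measure (shift_measure q) (sstart {..<q} v) = (1 / real q) ^ l" if "v \<in> V" for v
    using emeasure_cylinder[OF assms(1) V'(2)[OF that]] V'(1)[OF that]
    by (simp add: measure_def)
  then show "measure (shift_measure q) {s \<in> streams {..<q}. stake l s \<in> V} = real (card V) / real q ^ l"
    unfolding eq M.finite_measure_finite_Union[OF fin meas disj]
    by (simp add: power_one_over)
qed

section \<open>The coding map of a product of expansive Markov maps\<close>

locale coded_product_map =
  fixes q :: nat and I :: "real set" and \<P> :: "'d::finite \<Rightarrow> real set set"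
    and f :: "'d \<Rightarrow> real \<Rightarrow> real" and T :: "real ^ 'd \<Rightarrow> real ^ 'd"
    and R :: "nat \<Rightarrow> (real ^ 'd) set" and \<pi> :: "nat stream \<Rightarrow> real ^ 'd"
  assumes q: "2 \<le> q"
    and expansive: "\<And>i. expansive_markov_map I (\<P> i) (f i)"
    and T: "T = product_map f"
    and conj: "conjugate_to_full_shift q I \<P> T R \<pi>"
begin

abbreviation M :: "nat stream measure" where "M \<equiv> shift_measure q"

abbreviation \<mu> :: "(real ^ 'd) measure" where "\<mu> \<equiv> induced_measure q I \<pi>"

text \<open>Reading off the factors as projections makes them functions of the symbol, without choosing a
  factorisation of each rectangle.\<close>

definition cell :: "'d \<Rightarrow> nat \<Rightarrow> real set" where
  "cell i a = (\<lambda>x. x $ i) ` R a"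

sublocale M: prob_space M
  using q by (intro shift_measure_prob_space) auto

lemma q_pos: "0 < q" using q by simp

lemma partition_interval: "J \<in> \<P> i \<Longrightarrow> \<exists>a b. a < b \<and> J = {a..b}"
  using expansive[of i] by (auto simp: expansive_markov_map_def markov_partition_def closed_interval_def)

text \<open>The cells are nonempty, so the projections of a box are its factors.\<close>

lemma product_cell:
  assumes "\<And>i. J i \<in> \<P> i" "R a = {x. \<forall>i. x $ i \<in> J i}"
  shows "cell i a = J i"
proof
  show "cell i a \<subseteq> J i" using assms(2) by (auto simp: cell_def)
  show "J i \<subseteq> cell i a"
  proof
    fix y assume y: "y \<in> J i"
    have "\<exists>z. z \<in> J i'" for i' using partition_interval[OF assms(1)[of i']] by force
    then have "\<exists>z. \<forall>i'. z i' \<in> J i'" by (intro choice allI)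
    then obtain z where z: "\<And>i'. z i' \<in> J i'" by blast
    let ?x = "(\<chi> i'. if i' = i then y else z i') :: real ^ 'd"
    have "?x \<in> R a" using z y assms(2) by auto
    then show "y \<in> cell i a" unfolding cell_def by (intro image_eqI[of _ _ ?x]) auto
  qed
qed

lemma cell_in_partition: "a < q \<Longrightarrow> cell i a \<in> \<P> i"
  and R_eq_cells: "a < q \<Longrightarrow> R a = {x. \<forall>i. x $ i \<in> cell i a}"
proof -
  assume "a < q"
  then have "R a \<in> product_partition \<P>"
    using conj unfolding conjugate_to_full_shift_def by (blast dest: bij_betwE)
  then obtain J where J: "\<And>i. J i \<in> \<P> i" "R a = {x. \<forall>i. x $ i \<in> J i}"
    unfolding product_partition_def by blast
  then show "cell i a \<in> \<P> i" "R a = {x. \<forall>i. x $ i \<in> cell i a}"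
    using product_cell[OF J] by auto
qed

lemma interior_R:
  assumes "a < q"
  shows "interior (R a) = {x. \<forall>i. x $ i \<in> interior (cell i a)}"
proof -
  have "\<exists>lu. cell i a = {fst lu..snd lu}" for i
    using partition_interval[OF cell_in_partition[OF assms], of i] by (metis fst_conv snd_conv)
  then have "\<exists>lu. \<forall>i. cell i a = {fst (lu i)..snd (lu i)}" by (intro choice allI)
  then obtain lu where lu: "\<And>i. cell i a = {fst (lu i)..snd (lu i)}" by blast
  have "R a = cbox (\<chi> i. fst (lu i)) (\<chi> i. snd (lu i))" unfolding R_eq_cells[OF assms] by (auto simp: mem_box_cart lu)
  then show ?thesis by (auto simp: mem_box_cart lu)
qed

lemma closed_R: "a < q \<Longrightarrow> closed (R a)"
proof -
  assume "a < q"
  have "closed ((\<lambda>x. x $ i) -` cell i a)" for i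
    using partition_interval[OF cell_in_partition[OF \<open>a < q\<close>, of i]] by (intro closed_vimage_vec_nth) auto
  then have "closed (\<Inter>i. (\<lambda>x. x $ i) -` cell i a)" by auto
  moreover have "R a = (\<Inter>i. (\<lambda>x. x $ i) -` cell i a)" using R_eq_cells[OF \<open>a < q\<close>] by auto
  ultimately show ?thesis by simp
qed

lemma interior_cell_disjoint:
  assumes "a < q" "b < q" "cell i a \<noteq> cell i b"
  shows "interior (cell i a) \<inter> interior (cell i b) = {}"
proof -
  have "\<forall>J\<in>\<P> i. \<forall>K\<in>\<P> i. J \<noteq> K \<longrightarrow> interior J \<inter> interior K = {}"
    using expansive[of i] by (simp add: expansive_markov_map_def markov_partition_def)
  then show ?thesis using cell_in_partition[OF assms(1)] cell_in_partition[OF assms(2)] assms(3) by blast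
qed

lemma interior_R_disjoint:
  assumes "a < q" "b < q" "a \<noteq> b"
  shows "interior (R a) \<inter> interior (R b) = {}"
proof -
  have "inj_on R {..<q}" using conj unfolding conjugate_to_full_shift_def by (blast dest: bij_betw_imp_inj_on)
  then have "R a \<noteq> R b" using assms by (simp add: inj_on_eq_iff)
  then obtain i where "cell i a \<noteq> cell i b"
    unfolding R_eq_cells[OF assms(1)] R_eq_cells[OF assms(2)] by (cases "\<forall>i. cell i a = cell i b") auto
  from interior_cell_disjoint[OF assms(1,2) this] show ?thesis
    unfolding interior_R[OF assms(1)] interior_R[OF assms(2)] by blast
qed

lemma isCont_T:
  assumes "a < q" "x \<in> interior (R a)"
  shows "isCont T x"
  unfolding T product_map_def isCont_def
proof (rule tendsto_vec_lambda)
  fix i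
  have "x $ i \<in> interior (cell i a)" using assms interior_R by auto
  then have "isCont (f i) (x $ i)"
    by (intro DERIV_isCont[OF expansive_deriv(1)[OF expansive cell_in_partition[OF assms(1)]]])
  then have "isCont (\<lambda>x. f i (x $ i)) x" by (intro isCont_o2[of x _ "f i"]) auto
  then show "((\<lambda>x. f i (x $ i)) \<longlongrightarrow> f i (x $ i)) (at x)" by (simp add: isCont_def)
qed

lemma T_funpow_component: "(T ^^ j) x $ i = (f i ^^ j) (x $ i)"
  by (induction j) (auto simp: T product_map_def)

lemma closed_interval_I: "\<exists>a b. I = {a..b}"
  using expansive[of undefined] by (auto simp: expansive_markov_map_def markov_partition_def closed_interval_def)

lemma closed_cube: "closed (cube I :: (real ^ 'd) set)"
proof -
  have "closed (\<Inter>i. (\<lambda>x. x $ i) -` I :: (real ^ 'd) set)"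
    using closed_interval_I by (intro closed_INT ballI closed_vimage_vec_nth) auto
  moreover have "cube I = (\<Inter>i. (\<lambda>x. x $ i) -` I :: (real ^ 'd) set)" by (auto simp: cube_def)
  ultimately show ?thesis by simp
qed

lemma coding: "coding_map q I T R \<pi>"
  using conj unfolding conjugate_to_full_shift_def by (elim conjE)

lemma conjugacy: "metric_conjugacy M stl \<mu> T \<pi>"
  using conj unfolding conjugate_to_full_shift_def by (elim conjE)

lemma coding_intersection:
  assumes "s \<in> streams {..<q}"
  shows "(\<Inter>n. closure (open_itinerary I T R (stake n s))) = {\<pi> s}"
  using coding[unfolded coding_map_def] assms by (rule bspec)

lemma coding_mem_closure:
  assumes "s \<in> streams {..<q}"
  shows "\<pi> s \<in> closure (open_itinerary I T R (stake n s))"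
proof -
  have "\<pi> s \<in> (\<Inter>n. closure (open_itinerary I T R (stake n s)))"
    unfolding coding_intersection[OF assms] by simp
  then show ?thesis by (rule INT_D) simp
qed

lemma coding_unique:
  assumes "s \<in> streams {..<q}" "\<And>n. x \<in> closure (open_itinerary I T R (stake n s))"
  shows "\<pi> s = x"
proof -
  have "x \<in> (\<Inter>n. closure (open_itinerary I T R (stake n s)))" using assms(2) by simp
  then show ?thesis unfolding coding_intersection[OF assms(1)] by simp
qed

lemma coding_measurable: "\<pi> \<in> measurable M (restrict_space borel (cube I))"
proof -
  have "\<pi> \<in> measurable M \<mu>" using conjugacy unfolding metric_conjugacy_def by (elim conjE)
  then show ?thesis by (simp add: induced_measure_def)
qed

lemma coding_in_cube: "s \<in> streams {..<q} \<Longrightarrow> \<pi> s \<in> cube I"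
  using measurable_space[OF coding_measurable] by (simp add: space_shift_measure space_restrict_space)

lemma coding_equivariant_AE: "AE s in M. \<pi> (stl s) = T (\<pi> s)"
proof -
  have "\<exists>Z\<in>null_sets M. \<forall>x\<in>space M - Z. \<pi> (stl x) = T (\<pi> x)"
    using conjugacy unfolding metric_conjugacy_def by meson
  then obtain Z where "Z \<in> null_sets M" "\<forall>x\<in>space M - Z. \<pi> (stl x) = T (\<pi> x)" by auto
  then show ?thesis by (intro AE_I'[of Z]) auto
qed

lemma open_itinerary_component:
  assumes "set v \<subseteq> {..<q}" "x \<in> open_itinerary I T R v"
  shows "x $ i \<in> cell_itinerary (f i) (map (cell i) v)"
  unfolding cell_itinerary_def
proof (intro CollectI allI impI)
  fix j assume "j < length (map (cell i) v)"
  then have j: "j < length v" by simp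
  then have "v ! j < q" using assms(1) nth_mem by blast
  moreover have "(T ^^ j) x \<in> interior (R (v ! j))" using assms(2) j by (simp add: open_itinerary_def)
  ultimately show "(f i ^^ j) (x $ i) \<in> interior (map (cell i) v ! j)"
    using j by (auto simp: interior_R T_funpow_component)
qed

lemma coding_component_closure:
  assumes "s \<in> streams {..<q}"
  shows "\<pi> s $ i \<in> closure (cell_itinerary (f i) (map (cell i) (stake n s)))" (is "_ \<in> closure ?K")
proof -
  have "open_itinerary I T R (stake n s) \<subseteq> (\<lambda>x. x $ i) -` closure ?K"
    using open_itinerary_component[OF set_stake_subset[OF assms]] closure_subset[of ?K] by blast
  then have "closure (open_itinerary I T R (stake n s)) \<subseteq> (\<lambda>x. x $ i) -` closure ?K"
    by (intro closure_minimal closed_vimage_vec_nth) auto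
  then show ?thesis using coding_mem_closure[OF assms, of n] by auto
qed

text \<open>Some symbol has another cell in direction \<open>i\<close>, because the partition in that direction has a second
  cell and the symbols exhaust all products of cells.\<close>

lemma card_cell_fibre: "card {a \<in> {..<q}. cell i a = J} \<le> q - 1"
proof -
  have "\<exists>a<q. cell i a \<noteq> J"
  proof (rule ccontr)
    assume a: "\<not> ?thesis"
    then have J: "J \<in> \<P> i" using cell_in_partition[of 0 i] q_pos by auto
    then obtain K where K: "K \<in> \<P> i" "K \<noteq> J" using expansive_two_cells[OF expansive] by blast
    define F where "F i' = (if i' = i then K else cell i' 0)" for i'
    have F: "F i' \<in> \<P> i'" for i' using K cell_in_partition[OF q_pos] by (auto simp: F_def)
    then have "{x. \<forall>i. x $ i \<in> F i} \<in> product_partition \<P>" by (auto simp: product_partition_def)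
    then obtain b where b: "b < q" "R b = {x. \<forall>i. x $ i \<in> F i}"
      using conj bij_betw_imp_surj_on[of R "{..<q}" "product_partition \<P>"]
      unfolding conjugate_to_full_shift_def by (metis (no_types, lifting) imageE lessThan_iff)
    then have "cell i b = K" using product_cell[OF F b(2)] by (simp add: F_def)
    then show False using a b K by auto
  qed
  then obtain a where "a < q" "cell i a \<noteq> J" by blast
  then have "card {a \<in> {..<q}. cell i a = J} \<le> card ({..<q} - {a})" by (intro card_mono) auto
  then show ?thesis using \<open>a < q\<close> by simp
qed

text \<open>If \<open>\<pi> s\<close> lies on the hyperplane, the coordinate itinerary of every prefix of \<open>s\<close> has \<open>c\<close> in its
  closure. For prefixes of length \<open>n\<close> this happens with probability at most \<open>3 * ((q - 1) / q) ^ n\<close>.\<close>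

lemma coding_avoids_hyperplane: "AE s in M. \<pi> s $ i \<noteq> c"
proof -
  let ?E = "{s \<in> space M. \<pi> s $ i = c}"
  let ?V = "\<lambda>n. {v. set v \<subseteq> {..<q} \<and> length v = n \<and> c \<in> closure (cell_itinerary (f i) (map (cell i) v))}"
  have \<pi>: "\<pi> \<in> borel_measurable M" using coding_measurable by (simp add: measurable_restrict_space2_iff)
  have E: "?E \<in> sets M"
  proof -
    have "(\<lambda>s. \<pi> s $ i) \<in> borel_measurable M"
      by (rule measurable_compose[OF \<pi>]) (intro borel_measurable_continuous_onI continuous_intros)
    then show ?thesis by measurable
  qed
  have bound: "measure M ?E \<le> 3 * (real (q - 1) / real q) ^ n" for n
  proof -
    have "?E \<subseteq> {s \<in> streams {..<q}. stake n s \<in> ?V n}"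
      using coding_component_closure[of _ i n] by (auto simp: space_shift_measure dest: set_stake_subset)
    then have "measure M ?E \<le> measure M {s \<in> streams {..<q}. stake n s \<in> ?V n}"
      by (intro M.finite_measure_mono measure_prefix_set q_pos) auto
    also have "\<dots> = real (card (?V n)) / real q ^ n" using q_pos by (intro measure_prefix_set) auto
    also have "card (?V n) \<le> 3 * (q - 1) ^ n"
    proof (rule card_words_near_point)
      fix a assume a: "a \<in> {..<q}"
      then obtain l u where "cell i a = {l..u}" using partition_interval[OF cell_in_partition] by force
      then show "is_interval (interior (cell i a))" by simp
      show "(f i has_real_derivative deriv (f i) x) (at x) \<and> deriv (f i) x \<noteq> 0" if "x \<in> interior (cell i a)" for x
        using expansive_deriv[OF expansive cell_in_partition] a that by auto
    qed (use card_cell_fibre interior_cell_disjoint in auto)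
    then have "real (card (?V n)) / real q ^ n \<le> real (3 * (q - 1) ^ n) / real q ^ n"
      by (intro divide_right_mono of_nat_mono) auto
    also have "\<dots> = 3 * (real (q - 1) / real q) ^ n" by (simp add: power_divide)
    finally show ?thesis by simp
  qed
  have "(\<lambda>n. 3 * (real (q - 1) / real q) ^ n) \<longlonglongrightarrow> 3 * 0"
    using q by (intro tendsto_intros LIMSEQ_power_zero) auto
  then have "measure M ?E \<le> 3 * 0" by (rule LIMSEQ_le_const) (use bound in blast)
  then have "measure M ?E = 0" using measure_nonneg[of M ?E] by linarith
  then have "?E \<in> null_sets M" using E by (simp add: M.emeasure_eq_measure null_setsI)
  then show ?thesis by (intro AE_I'[of ?E]) auto
qed

text \<open>A coded point lies in the closed rectangle of the first symbol, and the boundary of that rectangle is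
  contained in finitely many hyperplanes.\<close>

lemma coding_interior_AE: "AE s in M. \<pi> s \<in> interior (R (shd s))"
proof -
  define E where "E i = (\<Union>a<q. cell i a - interior (cell i a))" for i
  have "finite (E i)" for i unfolding E_def
  proof (rule finite_UN_I)
    fix a assume "a \<in> {..<q}"
    then obtain l u where "cell i a = {l..u}" using partition_interval[OF cell_in_partition] by force
    then have "cell i a - interior (cell i a) \<subseteq> {l, u}" by auto
    then show "finite (cell i a - interior (cell i a))" by (rule finite_subset) simp
  qed simp
  then have "AE s in M. \<forall>i\<in>UNIV. \<forall>c\<in>E i. \<pi> s $ i \<noteq> c"
    by (intro AE_finite_allI coding_avoids_hyperplane) auto
  then show ?thesis using AE_space
  proof eventually_elim
    case (elim s)
    then have s: "s \<in> streams {..<q}" and a: "shd s < q"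
      using streams_shd by (auto simp: space_shift_measure)
    have "open_itinerary I T R (stake 1 s) \<subseteq> R (shd s)"
      using interior_subset by (auto simp: open_itinerary_def)
    then have "\<pi> s \<in> R (shd s)"
      using coding_mem_closure[OF s, of 1] closure_minimal[OF _ closed_R[OF a]] by blast
    then have "\<pi> s $ i \<in> cell i (shd s)" for i using R_eq_cells[OF a] by auto
    moreover have "\<pi> s $ i \<notin> E i" for i using elim by auto
    ultimately show ?case using a by (auto simp: interior_R E_def)
  qed
qed

text \<open>For these sequences the conjugacy holds along the whole orbit, and the orbit never meets a boundary of
  the partition. Both are needed at all times \<open>j\<close>, so that the property is inherited by shifts.\<close>

definition generic :: "nat stream \<Rightarrow> bool" where
  "generic s \<longleftrightarrow> s \<in> streams {..<q} \<and>
     (\<forall>j. \<pi> (sdrop j s) \<in> interior (R (s !! j)) \<and> \<pi> (sdrop (Suc j) s) = T (\<pi> (sdrop j s)))"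

lemma generic_AE: "AE s in M. generic s"
proof -
  have "AE s in M. \<forall>j. \<pi> (sdrop j s) \<in> interior (R (shd (sdrop j s)))"
    unfolding AE_all_countable
    by (intro allI AE_shift_sdrop[where Q = "\<lambda>s. \<pi> s \<in> interior (R (shd s))"] q_pos coding_interior_AE)
  moreover have "AE s in M. \<forall>j. \<pi> (stl (sdrop j s)) = T (\<pi> (sdrop j s))"
    unfolding AE_all_countable
    by (intro allI AE_shift_sdrop[where Q = "\<lambda>s. \<pi> (stl s) = T (\<pi> s)"] q_pos coding_equivariant_AE)
  ultimately show ?thesis using AE_space
    by eventually_elim (simp add: generic_def space_shift_measure)
qed

lemma generic_sdrop: "generic s \<Longrightarrow> generic (sdrop j s)"
  by (auto simp: generic_def sdrop_add sdrop_snth streams_iff_snth simp del: sdrop.simps(2))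

lemma generic_orbit: "generic s \<Longrightarrow> (T ^^ j) (\<pi> s) = \<pi> (sdrop j s)"
  by (induction j) (auto simp: generic_def simp del: sdrop.simps(2))

lemma generic_symbol: "generic s \<Longrightarrow> s !! j < q"
  by (auto simp: generic_def streams_iff_snth)

text \<open>The orbit stays in the open rectangles, where \<open>T\<close> is continuous.\<close>

lemma generic_isCont:
  assumes "generic s"
  shows "isCont (T ^^ j) (\<pi> s)"
proof (induction j)
  case (Suc j)
  have "isCont T ((T ^^ j) (\<pi> s))"
    unfolding generic_orbit[OF assms]
    using assms by (intro isCont_T[of "s !! j"] generic_symbol) (auto simp: generic_def)
  with Suc have "isCont (\<lambda>x. T ((T ^^ j) x)) (\<pi> s)" by (rule isCont_o2)
  then show ?case by (simp add: o_def)
qed (simp add: id_def)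

text \<open>Suppose that another sequence \<open>s'\<close>, starting with \<open>v\<close>, codes the same point and differs from \<open>s\<close> at
  time \<open>j\<close>. Then the point is a limit of points that visit the open rectangle of the symbol \<open>s' !! j\<close> at that time, while
  by continuity points near it visit that of \<open>s !! j\<close>. These open rectangles are disjoint.\<close>

lemma generic_rectangle_iff:
  assumes s: "generic s" and v: "set v \<subseteq> {..<q}"
  shows "\<pi> s \<in> rectangle q \<pi> v \<longleftrightarrow> s \<in> sstart {..<q} v"
proof
  assume "s \<in> sstart {..<q} v"
  then show "\<pi> s \<in> rectangle q \<pi> v" by (auto simp: rectangle_def)
next
  assume "\<pi> s \<in> rectangle q \<pi> v"
  then obtain s' where s': "s' \<in> sstart {..<q} v" "\<pi> s = \<pi> s'" by (auto simp: rectangle_def)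
  have streams: "s \<in> streams {..<q}" using s by (simp add: generic_def)
  have streams': "s' \<in> streams {..<q}" using s'(1) sstart_in_streams[of v "{..<q}"] v by (auto simp: lists_eq_set)
  have "s !! j = v ! j" if "j < length v" for j
  proof (rule ccontr)
    assume neq: "s !! j \<noteq> v ! j"
    have v_j: "s' !! j = v ! j" "v ! j < q"
      using s'(1) that v unfolding sstart_eq[OF streams'] by (auto dest: nth_mem)
    have "(T ^^ j) (\<pi> s) \<in> interior (R (s !! j))"
      unfolding generic_orbit[OF s] using s by (simp add: generic_def)
    moreover have "((T ^^ j) \<longlongrightarrow> (T ^^ j) (\<pi> s)) (nhds (\<pi> s))"
      using generic_isCont[OF s, of j] by (simp add: isCont_def tendsto_at_iff_tendsto_nhds)
    ultimately have "eventually (\<lambda>y. (T ^^ j) y \<in> interior (R (s !! j))) (nhds (\<pi> s))"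
      by (intro topological_tendstoD) auto
    then obtain U where U: "open U" "\<pi> s \<in> U" "\<And>y. y \<in> U \<Longrightarrow> (T ^^ j) y \<in> interior (R (s !! j))"
      by (auto simp: eventually_nhds)
    have "\<pi> s \<in> closure (open_itinerary I T R (stake (Suc j) s'))"
      unfolding s'(2) by (rule coding_mem_closure[OF streams'])
    then have "U \<inter> open_itinerary I T R (stake (Suc j) s') \<noteq> {}"
      using U(1,2) open_Int_closure_eq_empty[OF U(1)] by blast
    then obtain y where y: "y \<in> U" "y \<in> open_itinerary I T R (stake (Suc j) s')" by auto
    have "(T ^^ j) y \<in> interior (R (stake (Suc j) s' ! j))"
      using y(2) by (simp add: open_itinerary_def del: stake.simps)
    then have "(T ^^ j) y \<in> interior (R (v ! j))" using v_j by (simp del: stake.simps)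
    then show False
      using U(3)[OF y(1)] interior_R_disjoint[OF generic_symbol[OF s] v_j(2) neq] by blast
  qed
  then show "s \<in> sstart {..<q} v" by (simp add: sstart_eq[OF streams])
qed

lemma rectangle_subset_closure:
  assumes "set u \<subseteq> {..<q}"
  shows "rectangle q \<pi> u \<subseteq> closure (open_itinerary I T R u)"
proof
  fix x assume "x \<in> rectangle q \<pi> u"
  then obtain s where s: "s \<in> sstart {..<q} u" "x = \<pi> s" by (auto simp: rectangle_def)
  have streams: "s \<in> streams {..<q}" using s(1) sstart_in_streams[of u "{..<q}"] assms by (auto simp: lists_eq_set)
  then have "stake (length u) s = u" using s(1) sstart_iff_stake[OF streams] by simp
  then show "x \<in> closure (open_itinerary I T R u)" using coding_mem_closure[OF streams, of "length u"] s by simp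
qed

lemma rectangle_split:
  assumes "set u \<subseteq> {..<q}"
  shows "rectangle q \<pi> u \<subseteq> (\<Union>a<q. rectangle q \<pi> (u @ [a]))"
proof
  fix x assume "x \<in> rectangle q \<pi> u"
  then obtain s where s: "s \<in> sstart {..<q} u" "x = \<pi> s" by (auto simp: rectangle_def)
  have streams: "s \<in> streams {..<q}" using s(1) sstart_in_streams[of u "{..<q}"] assms by (auto simp: lists_eq_set)
  then have "stake (length u) s = u" using s(1) sstart_iff_stake[OF streams] by simp
  then have "stake (Suc (length u)) s = u @ [s !! length u]" by (simp add: stake_Suc del: stake.simps)
  then have "s \<in> sstart {..<q} (u @ [s !! length u])" using sstart_iff_stake[OF streams] by simp
  moreover have "s !! length u < q" using streams by (simp add: streams_iff_snth)
  ultimately show "x \<in> (\<Union>a<q. rectangle q \<pi> (u @ [a]))" using s(2) by (auto simp: rectangle_def)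
qed

text \<open>A compactness argument as in Koenig's lemma: a limit point of the rectangle of a word is a limit point of
  the rectangle of one of its finitely many one-letter extensions. Following these extensions for ever
  gives a sequence, and uniqueness in the definition of the coding map shows that it codes the limit point.\<close>

lemma closed_rectangle:
  assumes v: "set v \<subseteq> {..<q}"
  shows "closed (rectangle q \<pi> v)"
proof -
  have "closure (rectangle q \<pi> v) \<subseteq> rectangle q \<pi> v"
  proof
    fix x assume x: "x \<in> closure (rectangle q \<pi> v)"
    define near where "near u \<longleftrightarrow> set u \<subseteq> {..<q} \<and> x \<in> closure (rectangle q \<pi> u)" for u
    define c where "c u = (SOME a. near (u @ [a]))" for u
    have step: "near (u @ [c u])" if u: "near u" for u
    proof -
      have "closure (rectangle q \<pi> u) \<subseteq> (\<Union>a<q. closure (rectangle q \<pi> (u @ [a])))"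
        using rectangle_split[of u] u closure_subset
        by (intro closure_minimal closed_UN) (auto simp: near_def, blast)
      then obtain a where "a < q" "x \<in> closure (rectangle q \<pi> (u @ [a]))" using u by (auto simp: near_def)
      then have "near (u @ [a])" using u by (simp add: near_def)
      then show ?thesis unfolding c_def by (rule someI)
    qed
    define W where "W = rec_nat v (\<lambda>_ u. u @ [c u])"
    have W_0: "W 0 = v" and W_Suc: "W (Suc n) = W n @ [c (W n)]" for n by (simp_all add: W_def)
    have near: "near (W n)" for n
      by (induction n) (use v x step in \<open>auto simp: W_0 W_Suc near_def[of v]\<close>)
    define s where "s = v @- smap (\<lambda>n. c (W n)) (fromN 0)"
    have stake_s: "stake (length v + n) s = W n" for n
    proof (induction n)
      case 0
      then show ?case by (simp add: s_def W_0 stake_shift)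
    next
      case (Suc n)
      have "s !! (length v + n) = c (W n)" by (simp add: s_def)
      then show ?case using Suc by (simp add: stake_Suc W_Suc del: stake.simps)
    qed
    have streams: "s \<in> streams {..<q}" unfolding streams_iff_snth
    proof
      fix k
      have "stake (length v + Suc k) s ! k = s !! k" by (intro stake_nth) simp
      then have "s !! k \<in> set (W (Suc k))"
        unfolding stake_s[symmetric] using nth_mem[of k "stake (length v + Suc k) s"]
        by (simp del: stake.simps)
      then show "s !! k \<in> {..<q}" using near[of "Suc k"] by (auto simp: near_def)
    qed
    have "\<pi> s = x"
    proof (rule coding_unique[OF streams])
      fix n
      have "stake n s = take n (W n)" unfolding stake_s[symmetric] by (simp add: take_stake)
      then have "open_itinerary I T R (W n) \<subseteq> open_itinerary I T R (stake n s)"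
        by (auto simp: open_itinerary_def)
      then have "rectangle q \<pi> (W n) \<subseteq> closure (open_itinerary I T R (stake n s))"
        using rectangle_subset_closure[of "W n"] near[of n] closure_mono unfolding near_def by blast
      then have "closure (rectangle q \<pi> (W n)) \<subseteq> closure (open_itinerary I T R (stake n s))"
        by (intro closure_minimal) auto
      then show "x \<in> closure (open_itinerary I T R (stake n s))" using near[of n] by (auto simp: near_def)
    qed
    moreover have "s \<in> sstart {..<q} v"
      using stake_s[of 0] by (simp add: sstart_iff_stake[OF streams] W_0)
    ultimately show "x \<in> rectangle q \<pi> v" by (auto simp: rectangle_def)
  qed
  then show ?thesis using closure_subset_eq by blast
qed

lemma cube_borel: "cube I \<in> sets (borel :: (real ^ 'd) measure)"
  using closed_cube by simp

lemma space_induced: "space \<mu> = cube I"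
  by (simp add: induced_measure_def space_restrict_space)

lemma sets_induced: "sets \<mu> = sets (restrict_space borel (cube I))"
  by (simp add: induced_measure_def)

lemma rectangle_sets:
  assumes "set v \<subseteq> {..<q}"
  shows "rectangle q \<pi> v \<in> sets \<mu>"
proof -
  have "sstart {..<q} v \<subseteq> streams {..<q}" using assms by (intro sstart_in_streams) auto
  then have "rectangle q \<pi> v \<subseteq> cube I" using coding_in_cube by (auto simp: rectangle_def)
  then show ?thesis using closed_rectangle[OF assms] cube_borel
    by (simp add: sets_induced sets_restrict_space_iff)
qed

lemma T_measurable_cube:
  "T \<in> measurable (restrict_space borel (cube I)) (restrict_space borel (cube I))"
proof (rule measurable_restrict_space2)
  have "f i ` I \<subseteq> I" for i using expansive[of i] by (simp add: expansive_markov_map_def)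
  then show "T \<in> space (restrict_space borel (cube I)) \<rightarrow> cube I"
    by (auto simp: T product_map_def cube_def space_restrict_space image_subset_iff)
  have comp: "(\<lambda>x. f i (x $ i)) \<in> borel_measurable (restrict_space borel (cube I))" for i
  proof -
    have "(\<lambda>x::real ^ 'd. x $ i) \<in> borel_measurable borel"
      by (intro borel_measurable_continuous_onI continuous_intros)
    then have "(\<lambda>x::real ^ 'd. x $ i) \<in> borel_measurable (restrict_space borel (cube I))"
      by (rule measurable_restrict_space1)
    then have "(\<lambda>x. x $ i) \<in> measurable (restrict_space borel (cube I)) (restrict_space borel I)"
      by (intro measurable_restrict_space2) (auto simp: cube_def space_restrict_space)
    moreover have "f i \<in> borel_measurable (restrict_space borel I)"
      using expansive_measurable[OF expansive, of i] by (simp add: measurable_restrict_space2_iff)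
    ultimately show ?thesis by (rule measurable_compose)
  qed
  show "T \<in> borel_measurable (restrict_space borel (cube I))"
    unfolding borel_measurable_euclidean_space[of T]
    using comp by (auto simp: Basis_vec_def inner_axis T product_map_def)
qed

lemma T_measurable: "T \<in> measurable \<mu> \<mu>"
  using T_measurable_cube by (simp add: induced_measure_def)

lemma induced_prob_space: "prob_space \<mu>"
  unfolding induced_measure_def by (intro M.prob_space_distr coding_measurable)

text \<open>Invariance is transported from the shift, as \<open>T \<circ> \<pi>\<close> and \<open>\<pi> \<circ> stl\<close> agree almost everywhere.\<close>

lemma T_invariant: "distr \<mu> \<mu> T = \<mu>"
proof -
  let ?N = "restrict_space borel (cube I) :: (real ^ 'd) measure"
  have stl: "stl \<in> measurable M M" unfolding shift_measure_def by (rule measurable_stl)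
  have "distr \<mu> \<mu> T = distr (distr M ?N \<pi>) ?N T"
    unfolding induced_measure_def by (intro distr_cong) auto
  also have "\<dots> = distr M ?N (T \<circ> \<pi>)"
    by (rule distr_distr[OF T_measurable_cube coding_measurable])
  also have "\<dots> = distr M ?N (\<pi> \<circ> stl)"
    using coding_equivariant_AE
    by (intro distr_cong_AE measurable_comp[OF coding_measurable T_measurable_cube]
        measurable_comp[OF stl coding_measurable]) (auto elim: eventually_mono)
  also have "\<dots> = distr (distr M M stl) ?N \<pi>"
    by (rule distr_distr[OF coding_measurable stl, symmetric])
  also have "\<dots> = \<mu>" by (simp add: distr_shift_stl[OF q_pos] induced_measure_def)
  finally show ?thesis .
qed

lemma measure_induced: "B \<in> sets \<mu> \<Longrightarrow> measure \<mu> B = measure M (\<pi> -` B \<inter> space M)"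
  unfolding induced_measure_def by (intro measure_distr coding_measurable) simp

text \<open>For generic \<open>s\<close>, hitting the rectangle of \<open>u\<close> at time \<open>j\<close> means that \<open>u\<close> occurs at position \<open>j\<close>
  of \<open>s\<close>. The positions up to \<open>h\<close> are exactly those at which \<open>u\<close> fits into the first \<open>h + L\<close> symbols.\<close>

lemma measure_survivors:
  assumes W: "finite W" "\<And>u. u \<in> W \<Longrightarrow> length u = L \<and> set u \<subseteq> {..<q}"
  shows "measure \<mu> (space \<mu> - hitting_set \<mu> T (\<Union>u\<in>W. rectangle q \<pi> u) h)
         = avoidance_prob {..<q} W (h + L)"
proof -
  let ?A = "\<Union>u\<in>W. rectangle q \<pi> u"
  let ?S = "space \<mu> - hitting_set \<mu> T ?A h"
  let ?V = "avoiders {..<q} W (h + L)"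
  have A: "?A \<in> sets \<mu>" using W rectangle_sets by (intro sets.finite_UN) auto
  have "(T ^^ j) -` ?A \<inter> space \<mu> \<in> sets \<mu>" for j
  proof -
    have "T ^^ j \<in> measurable \<mu> \<mu>"
    proof (induction j)
      case (Suc j)
      show ?case unfolding funpow.simps by (rule measurable_comp[OF Suc T_measurable])
    qed simp
    then show ?thesis using A by (rule measurable_sets)
  qed
  then have S: "?S \<in> sets \<mu>" unfolding hitting_set_def by (intro sets.Diff sets.top sets.finite_UN) auto
  have V: "?V \<subseteq> {v. set v \<subseteq> {..<q} \<and> length v = h + L}" by (auto simp: avoiders_def)
  have "AE s in M. s \<in> \<pi> -` ?S \<inter> space M \<longleftrightarrow> s \<in> {s \<in> streams {..<q}. stake (h + L) s \<in> ?V}"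
    using generic_AE
  proof eventually_elim
    case (elim s)
    have streams: "s \<in> streams {..<q}" using elim by (simp add: generic_def)
    have hit: "(T ^^ j) (\<pi> s) \<in> rectangle q \<pi> u \<longleftrightarrow> occurs_at u (stake (h + L) s) j"
      if "j \<le> h" "u \<in> W" for j u
    proof -
      have len: "length u = L" "set u \<subseteq> {..<q}" using W(2) that by auto
      have "sdrop j s \<in> streams {..<q}" using generic_sdrop[OF elim] by (simp add: generic_def)
      then have "(T ^^ j) (\<pi> s) \<in> rectangle q \<pi> u \<longleftrightarrow> (\<forall>i<L. s !! (j + i) = u ! i)"
        unfolding generic_orbit[OF elim] generic_rectangle_iff[OF generic_sdrop[OF elim] len(2)]
        by (simp add: sstart_eq len sdrop_snth)
      then show ?thesis using that by (simp add: occurs_at_def len)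
    qed
    have "\<pi> s \<in> ?S \<longleftrightarrow> (\<forall>j\<le>h. \<forall>u\<in>W. (T ^^ j) (\<pi> s) \<notin> rectangle q \<pi> u)"
      using coding_in_cube[OF streams] by (auto simp: hitting_set_def space_induced)
    also have "\<dots> \<longleftrightarrow> (\<forall>j\<le>h. \<forall>u\<in>W. \<not> occurs_at u (stake (h + L) s) j)" using hit by blast
    also have "\<dots> \<longleftrightarrow> avoids W (stake (h + L) s)"
    proof -
      have "j \<le> h" if "u \<in> W" "occurs_at u (stake (h + L) s) j" for u j
        using W(2)[OF that(1)] that(2) by (simp add: occurs_at_def)
      then show ?thesis unfolding avoids_def by blast
    qed
    also have "\<dots> \<longleftrightarrow> stake (h + L) s \<in> ?V"
      using set_stake_subset[OF streams] by (auto simp: avoiders_def)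
    finally show ?case using streams by (simp add: space_shift_measure)
  qed
  then have "measure M (\<pi> -` ?S \<inter> space M) = measure M {s \<in> streams {..<q}. stake (h + L) s \<in> ?V}"
    using S coding_measurable measure_prefix_set(1)[OF q_pos V]
    by (intro measure_eq_AE measurable_sets) (auto simp: sets_induced)
  also have "\<dots> = avoidance_prob {..<q} W (h + L)"
    unfolding measure_prefix_set(2)[OF q_pos V] by (simp add: avoidance_prob_def)
  finally show ?thesis using measure_induced[OF S] by simp
qed

lemma survival_exponent_union:
  assumes "finite W" "\<And>u. u \<in> W \<Longrightarrow> length u = L \<and> set u \<subseteq> {..<q}"
  shows "survival_exponent \<mu> T (\<Union>u\<in>W. rectangle q \<pi> u) = growth_exponent (avoidance_prob {..<q} W) L"
  by (intro ext) (simp add: survival_exponent_def growth_exponent_def measure_survivors[OF assms])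

lemma escape_rate_defined_union:
  assumes W: "finite W" "W \<noteq> {}" "\<And>u. u \<in> W \<Longrightarrow> length u = L \<and> set u \<subseteq> {..<q}"
  shows "escape_rate_defined \<mu> T (\<Union>u\<in>W. rectangle q \<pi> u)"
proof -
  let ?A = "\<Union>u\<in>W. rectangle q \<pi> u"
  have A: "?A \<in> sets \<mu>" using W rectangle_sets by (intro sets.finite_UN) auto
  obtain u where u: "u \<in> W" using W by auto
  have u': "set u \<subseteq> {..<q}" using W(3)[OF u] by simp
  have "0 < (1 / real q) ^ length u" using q_pos by simp
  also have "\<dots> = measure M (sstart {..<q} u)"
    using emeasure_cylinder[OF q_pos u'] by (simp add: measure_def)
  also have "\<dots> \<le> measure M (\<pi> -` ?A \<inter> space M)"
  proof (rule M.finite_measure_mono)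
    show "sstart {..<q} u \<subseteq> \<pi> -` ?A \<inter> space M"
      using u sstart_in_streams[of u "{..<q}"] u' by (auto simp: rectangle_def space_shift_measure lists_eq_set)
    show "\<pi> -` ?A \<inter> space M \<in> sets M"
      using A by (intro measurable_sets[OF coding_measurable]) (simp add: sets_induced)
  qed
  finally have "0 < measure \<mu> ?A" using measure_induced[OF A] by simp
  moreover have "convergent (survival_exponent \<mu> T ?A)"
  proof -
    have "survival_exponent \<mu> T ?A = growth_exponent (avoidance_prob {..<q} W) L"
      using W(1,3) by (rule survival_exponent_union)
    moreover have "{..<q} \<noteq> {}" using q_pos by auto
    ultimately show ?thesis using growth_exponent_avoidance_convergent[of "{..<q}" W L] by simp
  qed
  ultimately show ?thesis
    unfolding escape_rate_defined_def using induced_prob_space T_measurable T_invariant A by blast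
qed

end

section \<open>Comparison of the escape rates\<close>

theorem theorem5p1:
  fixes q n m k :: nat
    and I :: "real set"
    and \<P> :: "'d::finite \<Rightarrow> real set set"
    and f :: "'d \<Rightarrow> real \<Rightarrow> real"
    and T :: "real ^ 'd \<Rightarrow> real ^ 'd"
    and R :: "nat \<Rightarrow> (real ^ 'd) set"
    and \<pi> :: "nat stream \<Rightarrow> real ^ 'd"
    and \<mu> :: "(real ^ 'd) measure"
    and w :: "nat list"
    and ws :: "nat \<Rightarrow> nat list"
  assumes "2 \<le> q"
    and "\<forall>i. expansive_markov_map I (\<P> i) (f i)"
    and "T = product_map f"
    and "conjugate_to_full_shift q I \<P> T R \<pi>"
    and "\<mu> = induced_measure q I \<pi>"
    and "1 \<le> n" and "length w = n" and "set w \<subseteq> {..<q}"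
    and "n \<le> m" and "k = q ^ (m - n)"
    and "\<forall>i\<in>{1..k}. length (ws i) = m \<and> set (ws i) \<subseteq> {..<q}"
    and "property_P m k ws"
    and "n < m \<or> correlation_poly w w \<noteq> monom 1 (n - 1)"
  shows "escape_rate_defined \<mu> T (rectangle q \<pi> w) \<and>
         escape_rate_defined \<mu> T (\<Union>i\<in>{1..k}. rectangle q \<pi> (ws i)) \<and>
         escape_rate \<mu> T (rectangle q \<pi> w) <
           escape_rate \<mu> T (\<Union>i\<in>{1..k}. rectangle q \<pi> (ws i))"
proof -
  interpret coded_product_map q I \<P> f T R \<pi>
    by (rule coded_product_map.intro[OF assms(1) spec[OF assms(2)] assms(3,4)])
  define W where "W = ws ` {1..k}"
  have k: "1 \<le> k" using assms(1,10) by simp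
  have W: "length u = m \<and> set u \<subseteq> {..<q}" if "u \<in> W" for u using assms(11) that by (auto simp: W_def)
  have w: "length u = n \<and> set u \<subseteq> {..<q}" if "u \<in> {w}" for u using assms(7,8) that by simp
  have m: "1 \<le> m" using assms(6,9) by simp
  have cross: "\<not> overlap_agrees (ws i) (ws j) l"
    if "i \<in> {1..k}" "j \<in> {1..k}" "i \<noteq> j" "l < m" for i j l
  proof -
    have "correlation_poly (ws i) (ws j) = 0"
      using assms(12) that(1-3) unfolding property_P_def by blast
    moreover have "length (ws i) = m" using assms(11) that(1) by blast
    ultimately show ?thesis using that(4) by (simp add: correlation_poly_eq_0_iff)
  qed
  have self: "\<not> overlap_agrees (ws i) (ws i) l" if "i \<in> {1..k}" "0 < l" "l < m" for i l
  proof -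
    have len: "length (ws i) = m" using assms(11) that(1) by blast
    then have "ws i \<noteq> []" using m by auto
    moreover have "correlation_poly (ws i) (ws i) = monom 1 (m - 1)"
      using assms(12) that(1) unfolding property_P_def by blast
    ultimately show ?thesis using correlation_poly_trivial_iff[of "ws i"] that(2,3) len by simp
  qed
  have unc: "\<not> overlap_agrees u v l" if uv: "u \<in> W" "v \<in> W" "0 < l" "l < m" for u v l
  proof -
    obtain i j where "u = ws i" "i \<in> {1..k}" "v = ws j" "j \<in> {1..k}"
      using uv(1,2) unfolding W_def by (elim imageE)
    then show ?thesis using cross[of i j l] self[of i l] uv(3,4) by (cases "i = j") simp_all
  qed
  \<comment> \<open>Equal words agree at shift \<open>0\<close>, so property (P) makes the words distinct and the set \<open>W\<close> has
    \<open>k\<close> elements. This gives both holes the same measure.\<close>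
  have "inj_on ws {1..k}"
  proof (rule inj_onI, rule ccontr)
    fix i j assume ij: "i \<in> {1..k}" "j \<in> {1..k}" "ws i = ws j" "i \<noteq> j"
    have "overlap_agrees (ws i) (ws j) 0" using ij(3) by (simp add: overlap_agrees_def)
    then show False using cross[of i j 0] ij m by auto
  qed
  then have card_W: "card W = card {..<q} ^ (m - n)" using assms(10) by (simp add: W_def card_image)
  have neq: "n < m \<or> (\<exists>t. 0 < t \<and> t < n \<and> overlap_agrees w w t)"
  proof (cases "n < m")
    case False
    have "w \<noteq> []" using assms(6,7) by auto
    then show ?thesis using False assms(7,13) correlation_poly_trivial_iff[of w] by simp
  qed simp
  have less: "lim (growth_exponent (avoidance_prob {..<q} W) m) < lim (growth_exponent (avoidance_prob {..<q} {w}) n)"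
  proof (rule growth_exponent_avoidance_less[OF _ _ _ assms(7) _ assms(9) neq W card_W unc])
    show "{..<q} \<noteq> {}" using q_pos by auto
    show "2 \<le> card {..<q}" using assms(1) by simp
  qed (use assms(6) in auto)
  have "finite W" "W \<noteq> {}" using k by (auto simp: W_def)
  have hole: "(\<Union>i\<in>{1..k}. rectangle q \<pi> (ws i)) = (\<Union>u\<in>W. rectangle q \<pi> u)"
    and single: "rectangle q \<pi> w = (\<Union>u\<in>{w}. rectangle q \<pi> u)" by (auto simp: W_def)
  have "escape_rate_defined \<mu> T (\<Union>u\<in>{w}. rectangle q \<pi> u)"
    unfolding assms(5) by (rule escape_rate_defined_union[OF _ _ w]) auto
  moreover have "escape_rate_defined \<mu> T (\<Union>u\<in>W. rectangle q \<pi> u)"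
    unfolding assms(5) by (rule escape_rate_defined_union[OF \<open>finite W\<close> \<open>W \<noteq> {}\<close> W])
  moreover have "escape_rate \<mu> T (\<Union>u\<in>{w}. rectangle q \<pi> u) < escape_rate \<mu> T (\<Union>u\<in>W. rectangle q \<pi> u)"
  proof -
    have "survival_exponent \<mu> T (\<Union>u\<in>W. rectangle q \<pi> u) = growth_exponent (avoidance_prob {..<q} W) m"
      unfolding assms(5) using \<open>finite W\<close> W by (rule survival_exponent_union)
    moreover have "survival_exponent \<mu> T (\<Union>u\<in>{w}. rectangle q \<pi> u) = growth_exponent (avoidance_prob {..<q} {w}) n"
      unfolding assms(5) by (rule survival_exponent_union[OF _ w]) auto
    ultimately show ?thesis using less by (simp only: escape_rate_def ereal_minus_less_minus)
  qed
  ultimately show ?thesis unfolding hole single by blast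
qed

end
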